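(* (1) For every $a\in\mathbb{C}$ with $2a\notin\{0,-1,-2,\dots\}$, $$F\!\left(a,1-\tfrac12a;2a;-\tfrac12+\tfrac12\sqrt5\right)=\frac{5^{1/2-5a/4}\,(\sqrt5-1)^{a/2-1}\,\Gamma(\tfrac35)\,\Gamma(\tfrac45)\,\Gamma(a+\tfrac12)}{2^{-3a/2-1/5}\,\Gamma(\tfrac9{10})\,\Gamma(\tfrac12a+\tfrac25)\,\Gamma(\tfrac12a+\tfrac35)}.$$ (2) If $a=-2-2n$ with $n\in\mathbb{Z}_{\ge0}$, then $$F\!\left(a,1-\tfrac12a;2a;-\tfrac12+\tfrac12\sqrt5\right)=\frac{5^{5n/2+1/2}\,(\sqrt5+1)^{n+1}\,(\tfrac85,n)(\tfrac75,n)}{2^{7n+2}\,(\tfrac74,n)(\tfrac54,n)}.$$ (3) If $a=-1-2n$ with $n\in\mathbb{Z}_{\ge0}$, then $$F\!\left(a,1-\tfrac12a;2a;-\tfrac12+\tfrac12\sqrt5\right)=\frac{5^{5n/2+1/2}\,(\sqrt5+1)^{n+2}\,(\tfrac{11}{10},n)(\tfrac9{10},n)}{2^{7n+4}\,(\tfrac54,n)(\tfrac34,n)}.$$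
   Context: $F(a,b;c;x)=\sum_{n\ge0}\frac{(a,n)(b,n)}{(c,n)(1,n)}x^n$ with $(\alpha,n)=\Gamma(\alpha+n)/\Gamma(\alpha)$ (so $(\alpha,n)=\alpha(\alpha+1)\cdots(\alpha+n-1)$ for $n\ge0$) is the Gauss hypergeometric series. When $a$ and $c$ are non-positive integers with $c<a$, it is defined as the finite sum $F(a,b;c;x):=\sum_{n=0}^{|a|}\frac{(a,n)(b,n)}{(c,n)(1,n)}x^n$. For $t>0$ and $s\in\mathbb{C}$, $t^s=e^{s\log t}$ with real logarithm. $1/\Gamma$ is interpreted as $0$ at the poles of $\Gamma$. *)

theory Defs
  imports "HOL-Analysis.Analysis"
begin

(* The Gauss hypergeometric function.  The first branch is the convention for non-positive
   integers c < a, where the series is cut off at n = |a| before (c,n) vanishes.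
   The infinite sum is only meaningful for c outside {0,-1,-2,...} and where it converges,
   in particular for norm x < 1. *)
definition gauss_hypergeo :: "complex \<Rightarrow> complex \<Rightarrow> complex \<Rightarrow> complex \<Rightarrow> complex" where
  "gauss_hypergeo a b c x =
     (if a \<in> \<int>\<^sub>\<le>\<^sub>0 \<and> c \<in> \<int>\<^sub>\<le>\<^sub>0 \<and> Re c < Re a
      then \<Sum>n\<le>nat \<lfloor>norm a\<rfloor>.
             pochhammer a n * pochhammer b n / (pochhammer c n * pochhammer 1 n) * x ^ n
      else \<Sum>n.
             pochhammer a n * pochhammer b n / (pochhammer c n * pochhammer 1 n) * x ^ n)"

lemma gauss_hypergeo_eq_eval_fps:
  assumes "c \<notin> \<int>\<^sub>\<le>\<^sub>0"
  shows "gauss_hypergeo a b c x = eval_fps (fps_hypergeo [a, b] [c] 1) x"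
  using assms by (simp add: gauss_hypergeo_def eval_fps_def flip: pochhammer_fact)

lemma gauss_hypergeo_neg_int:
  assumes "k < m"
  shows "gauss_hypergeo (- of_nat k) b (- of_nat m) x =
    (\<Sum>n\<le>k. pochhammer (- of_nat k) n * pochhammer b n /
            (pochhammer (- of_nat m) n * pochhammer 1 n) * x ^ n)"
  using assms by (simp add: gauss_hypergeo_def)

end

theory Submission
  imports Defs "HOL-Complex_Analysis.Conformal_Mappings"
begin

text \<open>
  Write \<open>x = (sqrt 5 - 1) / 2\<close>, so \<open>x\<^sup>2 = 1 - x\<close>, and \<open>f a = F (a, 1 - a/2; 2a; x)\<close>.
  What singles out this argument is that the shift \<open>a \<mapsto> a + 2\<close>, which in general gives a
  three-term contiguity relation, degenerates at \<open>x\<close> to the first-order recurrence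
  \[ (3 + x) (5a + 4) (5a + 6) f (a + 2) = 16 (2a + 1) (2a + 3) f a. \]
  It is proved by creative telescoping: the difference of the two sides, summand by summand, is
  the difference of an explicit sequence (\<open>hyp_term_telescope\<close>), which rests on one polynomial
  identity modulo \<open>x\<^sup>2 = 1 - x\<close> (\<open>wz_poly_identity\<close>). The telescoped remainder tends to 0 for the
  infinite series and vanishes for the truncated sums. So the recurrence holds for both, and for
  negative integers \<open>a\<close> the product formulas follow by induction.

  For other \<open>a\<close> the right-hand side satisfies the same recurrence, hence it agrees with \<open>f\<close> up to
  a factor of period 2. A growth property has to exclude a nonconstant factor. For real
  \<open>a > 0\<close>, Euler's integral represents \<open>G a = Beta a a * f a\<close> as the integral of \<open>v * W powr (a/2)\<close>
  with a nonnegative function \<open>W\<close>, so that \<open>G\<close> is log-convex, as in the theorem of Bohr and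
  Mollerup. Comparing \<open>G (2N + 2\<theta>)\<close> with its neighbours \<open>G (2N)\<close> and \<open>G (2N + 2)\<close> gives
  \<open>G (2N + 2\<theta>) / G (2N) \<longlonglongrightarrow> r powr \<theta>\<close>, where \<open>r\<close> is the limit of \<open>G (a + 2) / G a\<close>
  (\<open>euler_int_ratio_tendsto\<close>). Together with the recurrence and Euler's limit for the Gamma
  function this determines \<open>G\<close> on the interval \<open>(0, 2]\<close> from its value at 2
  (\<open>euler_int_closed_form\<close>).

  The identity theorem carries the result from the interval to the half-plane \<open>Re a > 0\<close>, and the
  recurrence, read backwards, from there to every \<open>a\<close> for which \<open>2a\<close> is not a nonpositive integer
  (\<open>hyp_sum_closed_form\<close>).
\<close>

section \<open>A first-order recurrence by creative telescoping\<close>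

definition hyp_term :: "'a::field_char_0 \<Rightarrow> 'a \<Rightarrow> nat \<Rightarrow> 'a" where
  "hyp_term x a k = pochhammer a k * pochhammer (1 - a/2) k
                   / (pochhammer (2*a) k * pochhammer 1 k) * x ^ k"

text \<open>
  The polynomial part of the telescoping certificate. With an unknown cubic in \<open>m\<close>, the Gosper
  equation of the lemma below is a homogeneous linear system of six equations for six unknowns:
  the four coefficients and the two factors of the recurrence. At \<open>x\<^sup>2 = 1 - x\<close> it has a nonzero
  solution, given here.
\<close>

definition wz_poly :: "'a::field_char_0 \<Rightarrow> 'a \<Rightarrow> 'a \<Rightarrow> 'a" where
  "wz_poly x a m =
     (9*a^3 + 15*a^2 + 7*a) + (11/4*a^3 + 4*a^2 + 2*a) * x
     + ((12*a^2 + 33/2*a + 4) + (17/4*a^2 + 7*a + 2) * x) * m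
     + ((13/2*a + 6) + (5/2*a + 3) * x) * m^2 + (2 + x) * m^3"

text \<open>
  The coefficients of \<open>wz_poly\<close> are reduced modulo \<open>x\<^sup>2 = 1 - x\<close>, so the two sides differ by an
  explicit multiple of \<open>1 - x - x\<^sup>2\<close>; it comes from the product of \<open>x\<close> with the part of \<open>wz_poly\<close>
  that is linear in \<open>x\<close>.
\<close>

lemma wz_poly_identity:
  fixes x a k :: "'a::field_char_0"
  assumes x: "x^2 = 1 - x"
  shows "- (3 + x) * a * (5*a+4) * (5*a+6) * (a+k) * (a+k+1)
           - 8 * (k - a/2) * (2*a+k) * (2*a+k+1) * (2*a+k+2) * (2*a+k+3)
         = 8 * (x * (a+k) * (k - a/2) * wz_poly x a (k+1) - k * (2*a+k+3) * wz_poly x a k)" (is "?L = ?R")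
proof -
  have "?L - ?R = (1 - x - x^2) * (8 * (a+k) * (k-a/2) * ((11/4*a^3 + 4*a^2 + 2*a) + (17/4*a^2 + 7*a + 2) * (k+1)
     + (5/2*a + 3) * (k+1)^2 + (k+1)^3))"
    unfolding wz_poly_def by (simp add: field_simps power2_eq_square power3_eq_cube)
  then show ?thesis using x by simp
qed
text \<open>
  The factor in parentheses is the \<open>n\<close>-th hypergeometric term divided by the four factors
  \<open>2a + n, \<dots>, 2a + n + 3\<close>. In this form the remainder is a multiple of \<open>a + n\<close>, which is 0 at the
  last index of a terminating sum, and there is no division by \<open>n - a/2\<close>, which would fail
  for even positive integers \<open>a\<close>.
\<close>

definition wz_remainder :: "'a::field_char_0 \<Rightarrow> 'a \<Rightarrow> nat \<Rightarrow> 'a" where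
  "wz_remainder x a n = 16 * (2*a+1) * (2*a+3) * x * (a + of_nat n) * wz_poly x a (of_nat n + 1)
     * (pochhammer a n * pochhammer (1 - a/2) n * x ^ n / (pochhammer (2*a) (n+4) * fact n))"

lemma pochhammer_2: "pochhammer z 2 = z * (z + 1)"
  and pochhammer_4: "pochhammer z 4 = z * (z + 1) * (z + 2) * (z + 3)"
  by (simp_all add: eval_nat_numeral pochhammer_Suc)

text \<open>
  In the induction step all four quantities (the two new terms, the old and the new remainder) are
  polynomial multiples of one common expression \<open>u\<close>; dividing by it leaves exactly
  \<open>wz_poly_identity\<close> at \<open>k = n + 1\<close>. The hypothesis asks only that the first few factors of the
  denominators are nonzero, so that the lemma covers the truncated sums too.
\<close>

lemma hyp_term_telescope:
  fixes x a :: "'a::field_char_0"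
  assumes x: "x^2 = 1 - x" and nz: "pochhammer (2*a) (n+4) \<noteq> 0"
  shows "(\<Sum>k\<le>n. (3+x) * (5*a+4) * (5*a+6) * hyp_term x (a+2) k - 16 * (2*a+1) * (2*a+3) * hyp_term x a k)
           = wz_remainder x a n"
  using nz
proof (induction n)
  case 0
  have "pochhammer (2*a) 4 = 2*a*(2*a+1)*(2*a+2)*(2*a+3)"
    by (simp add: pochhammer_4)
  with 0 have "2*a*(2*a+1)*(2*a+2)*(2*a+3) \<noteq> 0" by simp
  then have nz: "a \<noteq> 0" "2*a+1 \<noteq> 0" "2*a+2 \<noteq> 0" "2*a+3 \<noteq> 0" by auto
  have nz1: "a + 1 \<noteq> 0" using \<open>2*a+2 \<noteq> 0\<close> by (metis distrib_left mult_2 mult_zero_right one_add_one mult.right_neutral)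
  have a2: "2*a+2 = 2*(a+1)" by simp
  have "wz_remainder x a 0 = 16 * (2*a+1) * (2*a+3) * x * a * wz_poly x a 1 / (2*a*(2*a+1)*(2*a+2)*(2*a+3))"
    using \<open>pochhammer (2*a) 4 = _\<close> by (simp add: wz_remainder_def)
  also have "\<dots> = 4 * (x * wz_poly x a 1) / (a+1)"
    using nz nz1 by (simp add: divide_simps) (simp add: algebra_simps)
  also have "x * wz_poly x a 1 = (a+1) * ((3+x) * (5*a+4) * (5*a+6) - 16 * (2*a+1) * (2*a+3)) / 4"
  proof -
    have "x * wz_poly x a 1 - (a+1) * ((3+x) * (5*a+4) * (5*a+6) - 16 * (2*a+1) * (2*a+3)) / 4
      = (x^2 + x - 1) * ((11/4*a^3 + 4*a^2 + 2*a) + (17/4*a^2 + 7*a + 2) + (5/2*a + 3) + 1)"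
      unfolding wz_poly_def by (simp add: field_simps power2_eq_square power3_eq_cube)
    then show ?thesis using x by simp
  qed
  finally have "wz_remainder x a 0 = (3+x) * (5*a+4) * (5*a+6) - 16 * (2*a+1) * (2*a+3)"
    using nz1 by simp
  then show ?case by (simp add: hyp_term_def)
next
  case (Suc n)
  define k where "k = (of_nat (Suc n) :: 'a)"
  define W where "W = pochhammer (2*a) (Suc n + 4)"
  define P where "P = pochhammer a n"
  define Q where "Q = pochhammer (1 - a/2) n"
  define D where "D = pochhammer (2*a) n"
  have k: "of_nat n = k - 1" by (simp add: k_def)
  \<comment> \<open>the common factor of both terms and both remainders\<close>
  define u where "u = P * (a+k-1) * Q * x ^ Suc n / (W * fact (Suc n))"
  have W4: "W = pochhammer (2*a) (n+4) * (2*a+k+3)"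
    unfolding W_def add_Suc pochhammer_Suc by (simp add: k)
  have W1: "pochhammer (2*a) (n+4) = D * (2*a+k-1) * (2*a+k) * (2*a+k+1) * (2*a+k+2)"
    unfolding D_def pochhammer_product' pochhammer_4 by (simp add: k algebra_simps)
  have W0: "pochhammer (2*a) (n+4) = (2*a) * (2*a+1) * (2*a+2) * (2*a+3) * pochhammer (2*a+4) n"
    using pochhammer_product'[of "2*a" 4 n] by (simp add: pochhammer_4 add.commute)
  have Wnz: "W \<noteq> 0" using Suc.prems by (simp add: W_def)
  have nz: "a \<noteq> 0" "2*a+1 \<noteq> 0" "2*a+2 \<noteq> 0" "2*a+3 \<noteq> 0" "D \<noteq> 0"
           "2*a+k-1 \<noteq> 0" "2*a+k \<noteq> 0" "2*a+k+1 \<noteq> 0" "2*a+k+2 \<noteq> 0" "2*a+k+3 \<noteq> 0"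
    using Wnz W4 W1 W0 by auto
  have a2: "2*a+2 = 2*(a+1)" by simp
  then have nz1: "a+1 \<noteq> 0" using nz(3) by (metis mult_zero_right)
  have knz: "k \<noteq> 0" by (simp add: k_def del: of_nat_Suc)
  have fk: "fact (Suc n) = k * fact n" by (simp add: k_def)
  have t0: "hyp_term x a (Suc n) = (k - a/2) * (2*a+k) * (2*a+k+1) * (2*a+k+2) * (2*a+k+3) * u"
  proof -
    have "hyp_term x a (Suc n) = P * (a+k-1) * (Q * (k - a/2)) / (D * (2*a+k-1) * (k * fact n)) * x ^ Suc n"
    proof -
      have "a + of_nat n = a + k - 1" "1 - a/2 + of_nat n = k - a/2" "2*a + of_nat n = 2*a + k - 1"
        by (simp_all add: k)
      then show ?thesis
        unfolding hyp_term_def pochhammer_fact[symmetric] fk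
        unfolding pochhammer_Suc P_def Q_def D_def by (simp add: add_diff_eq k)
    qed
    then show ?thesis using nz knz unfolding u_def W4 W1 fk by (simp add: mult_ac)
  qed
  have t2: "hyp_term x (a+2) (Suc n) = - 2 * a * (2*a+1) * (2*a+3) * (a+k) * (a+k+1) * u"
  proof -
    have "pochhammer a (Suc n + 2) = a * (a+1) * pochhammer (a+2) (Suc n)"
      using pochhammer_product'[of a 2 "Suc n"] by (simp add: pochhammer_2 add.commute)
    moreover have "pochhammer a (Suc n + 2) = P * (a+k-1) * (a+k) * (a+k+1)"
      using pochhammer_product'[of a n 3]
      by (simp add: eval_nat_numeral pochhammer_Suc P_def k algebra_simps)
    ultimately have "pochhammer (a+2) (Suc n) * (a * (a+1)) = P * (a+k-1) * (a+k) * (a+k+1)"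
      by (simp only: mult_ac)
    then have p1: "pochhammer (a+2) (Suc n) = P * (a+k-1) * (a+k) * (a+k+1) / (a * (a+1))"
      using nz nz1 by (subst eq_divide_eq) simp
    have p2: "pochhammer (1 - (a+2)/2) (Suc n) = - (a/2) * Q"
      by (simp add: pochhammer_rec Q_def add_divide_distrib)
    have "2*(a+2) = 2*a+4" by simp
    have "pochhammer (2*(a+2)) (Suc n) * (2*a*(2*a+1)*(2*a+2)*(2*a+3)) = W"
      unfolding W_def \<open>2*(a+2) = 2*a+4\<close> using pochhammer_product'[of "2*a" 4 "Suc n"]
      by (simp only: pochhammer_4 add.commute mult.commute of_nat_numeral)
    then have p3: "pochhammer (2*(a+2)) (Suc n) = W / (2*a*(2*a+1)*(2*a+2)*(2*a+3))"
      using nz by (subst eq_divide_eq) simp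
    define c where "c = a + 1"
    have "c \<noteq> 0" "2*a+2 = 2*c" using nz1 by (simp_all add: c_def)
    then have "hyp_term x (a+2) (Suc n) = P * (a+k-1) * (a+k) * (a+k+1) / (a * c) * (- (a/2) * Q)
       / (W / (2*a*(2*a+1)*(2*c)*(2*a+3)) * fact (Suc n)) * x ^ Suc n"
      unfolding hyp_term_def p1 p2 p3 by (simp only: pochhammer_fact[symmetric] c_def)
    also have "\<dots> = - 2 * a * (2*a+1) * (2*a+3) * (a+k) * (a+k+1) * u"
      using nz \<open>c \<noteq> 0\<close> Wnz unfolding u_def by (simp add: divide_simps del: fact_Suc power_Suc)
    finally show ?thesis .
  qed
  have c0: "wz_remainder x a n = 16 * (2*a+1) * (2*a+3) * (wz_poly x a k * k * (2*a+k+3)) * u"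
    using nz knz unfolding wz_remainder_def u_def P_def Q_def W4 fk by (simp add: k add_diff_eq)
  have c1: "wz_remainder x a (Suc n) = 16 * (2*a+1) * (2*a+3) * (x * (a+k) * wz_poly x a (k+1) * (k - a/2)) * u"
    using Wnz unfolding wz_remainder_def u_def P_def Q_def W_def k_def[symmetric]
    unfolding pochhammer_Suc[of a n] pochhammer_Suc[of _ n] power_Suc[of _ n]
    by (simp add: k add_diff_eq)
  have IH: "(\<Sum>k\<le>n. (3+x) * (5*a+4) * (5*a+6) * hyp_term x (a+2) k - 16 * (2*a+1) * (2*a+3) * hyp_term x a k)
      = wz_remainder x a n"
    using Wnz W4 by (intro Suc.IH) auto
  have "wz_remainder x a (Suc n) - wz_remainder x a n =
     2 * (2*a+1) * (2*a+3) * u * (8 * (x * (a+k) * (k - a/2) * wz_poly x a (k+1) - k * (2*a+k+3) * wz_poly x a k))"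
    unfolding c0 c1 by (simp add: algebra_simps)
  also have "\<dots> = (3+x) * (5*a+4) * (5*a+6) * hyp_term x (a+2) (Suc n) - 16 * (2*a+1) * (2*a+3) * hyp_term x a (Suc n)"
    unfolding wz_poly_identity[OF x, symmetric] t0 t2 by (simp add: algebra_simps)
  finally have "wz_remainder x a (Suc n) = (3+x) * (5*a+4) * (5*a+6) * hyp_term x (a+2) (Suc n)
     - 16 * (2*a+1) * (2*a+3) * hyp_term x a (Suc n) + wz_remainder x a n"
    by (simp only: diff_eq_eq)
  then show ?case unfolding sum.atMost_Suc IH by (simp only: add.commute)
qed

lemma tendsto_of_nat_add_ratio:
  fixes b c :: "'a::real_normed_field"
  shows "(\<lambda>n. (of_nat n + b) / (of_nat n + c)) \<longlonglongrightarrow> 1"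
    and tendsto_inverse_of_nat_add: "(\<lambda>n. 1 / (of_nat n + c)) \<longlonglongrightarrow> 0"
proof -
  have lim: "filterlim (\<lambda>n. of_nat n + c) at_infinity sequentially"
    by (rule tendsto_add_filterlim_at_infinity'[OF tendsto_of_nat tendsto_const])
  have *: "(\<lambda>n. d / (of_nat n + c)) \<longlonglongrightarrow> 0" for d :: 'a
    by (rule tendsto_divide_0[OF tendsto_const lim])
  show "(\<lambda>n. 1 / (of_nat n + c)) \<longlonglongrightarrow> 0" by (rule *)
  have "\<forall>\<^sub>F n in sequentially. of_nat n + c \<noteq> 0"
    using lim by (auto simp: filterlim_at_infinity_conv_norm_at_top filterlim_at_top_dense elim!: allE[of _ 0] eventually_mono)
  then have "\<forall>\<^sub>F n in sequentially. 1 + (b - c) / (of_nat n + c) = (of_nat n + b) / (of_nat n + c)"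
    by eventually_elim (simp add: field_simps)
  then show "(\<lambda>n. (of_nat n + b) / (of_nat n + c)) \<longlonglongrightarrow> 1"
    by (rule Lim_transform_eventually[rotated]) (use tendsto_add[OF tendsto_const *[of "b - c"], of 1] in simp)
qed

definition hyp_sum :: "'a::{real_normed_field,banach} \<Rightarrow> 'a \<Rightarrow> 'a" where
  "hyp_sum x a = (\<Sum>k. hyp_term x a k)"

lemma pochhammer_double_nz:
  fixes a :: "'a::field_char_0"
  assumes "2 * a \<notin> \<int>\<^sub>\<le>\<^sub>0"
  shows "pochhammer (2*a) n \<noteq> 0"
  using assms by (auto simp: pochhammer_eq_0_iff)

lemma summable_hyp_term:
  fixes x a :: "'a::{real_normed_field,banach}"
  assumes x: "norm x < 1" and a: "2 * a \<notin> \<int>\<^sub>\<le>\<^sub>0"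
  shows "summable (hyp_term x a)"
proof -
  define q where "q = (\<lambda>n. (of_nat n + a) / (of_nat n + 2*a) * ((of_nat n + (1 - a/2)) / (of_nat n + 1)) * x)"
  have "q \<longlonglongrightarrow> 1 * 1 * x"
    unfolding q_def by (intro tendsto_intros tendsto_of_nat_add_ratio)
  then have "(\<lambda>n. norm (q n)) \<longlonglongrightarrow> norm x" by (auto intro: tendsto_norm)
  moreover obtain c where c: "norm x < c" "c < 1" using dense[OF x] by blast
  ultimately have "\<forall>\<^sub>F n in sequentially. norm (q n) < c"
    by (auto simp: order_tendsto_iff)
  then obtain N where N: "norm (q n) < c" if "n \<ge> N" for n
    by (auto simp: eventually_sequentially)
  have step: "hyp_term x a (Suc n) = q n * hyp_term x a n" for n
    unfolding hyp_term_def q_def pochhammer_Suc by (simp add: add_ac mult_ac)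
  show ?thesis
  proof (rule summable_ratio_test[OF c(2)])
    show "norm (hyp_term x a (Suc n)) \<le> c * norm (hyp_term x a n)" if "n \<ge> N" for n
      unfolding step norm_mult using N[OF that] by (intro mult_right_mono) auto
  qed
qed

text \<open>
  The remainder is the \<open>n\<close>-th term of a convergent series times a rational function of \<open>n\<close> with
  numerator and denominator of degree 4, which is bounded.
\<close>

lemma wz_remainder_tendsto_0:
  fixes x a :: "'a::{real_normed_field,banach}"
  assumes "norm x < 1" and "2 * a \<notin> \<int>\<^sub>\<le>\<^sub>0"
  shows "wz_remainder x a \<longlonglongrightarrow> 0"
proof -
  obtain c0 c1 c2 c3 where wz_poly: "wz_poly x a m = c0 + c1 * m + c2 * m^2 + c3 * m^3" for m
    unfolding wz_poly_def by blast
  define m where "m = (\<lambda>n. of_nat n + 1 :: 'a)"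
  define p where "p = (\<lambda>j n. of_nat n + (2 * a + j) :: 'a)"
  define h where "h = (\<lambda>n. (of_nat n + a) / p 0 n *
      (c0 * (1 / p 1 n) * (1 / p 2 n) * (1 / p 3 n) + c1 * (m n / p 1 n) * (1 / p 2 n) * (1 / p 3 n)
        + c2 * (m n / p 1 n) * (m n / p 2 n) * (1 / p 3 n) + c3 * (m n / p 1 n) * (m n / p 2 n) * (m n / p 3 n)))"
  have "h \<longlonglongrightarrow> 1 * (c0 * 0 * 0 * 0 + c1 * 1 * 0 * 0 + c2 * 1 * 1 * 0 + c3 * 1 * 1 * 1)"
    unfolding h_def p_def m_def
    by (intro tendsto_intros tendsto_of_nat_add_ratio tendsto_inverse_of_nat_add)
  from tendsto_mult[OF tendsto_mult[OF tendsto_const this] summable_LIMSEQ_zero[OF summable_hyp_term[OF assms]]]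
  have "(\<lambda>n. (16 * (2*a+1) * (2*a+3) * x) * h n * hyp_term x a n) \<longlonglongrightarrow> 0"
    by simp
  moreover have "(16 * (2*a+1) * (2*a+3) * x) * h n * hyp_term x a n = wz_remainder x a n" for n
  proof -
    have W: "pochhammer (2*a) (n+4) = pochhammer (2*a) n * (p 0 n * p 1 n * p 2 n * p 3 n)"
      unfolding pochhammer_product' pochhammer_4 by (simp add: p_def algebra_simps)
    have "pochhammer (2*a) (n+4) \<noteq> 0" by (rule pochhammer_double_nz[OF assms(2)])
    then have nz: "p 0 n \<noteq> 0" "p 1 n \<noteq> 0" "p 2 n \<noteq> 0" "p 3 n \<noteq> 0" "pochhammer (2*a) n \<noteq> 0" unfolding W by auto
    have h: "h n = (of_nat n + a) * wz_poly x a (m n) / (p 0 n * p 1 n * p 2 n * p 3 n)"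
      unfolding h_def wz_poly using nz by (simp add: field_simps power2_eq_square power3_eq_cube)
    show ?thesis unfolding h hyp_term_def wz_remainder_def W m_def
      by (simp add: pochhammer_fact[symmetric] add.commute mult_ac)
  qed
  ultimately show ?thesis by simp
qed

lemma hyp_sum_recurrence:
  fixes x a :: "'a::{real_normed_field,banach}"
  assumes "x^2 = 1 - x" "norm x < 1" and a: "2 * a \<notin> \<int>\<^sub>\<le>\<^sub>0"
  shows "(3+x) * (5*a+4) * (5*a+6) * hyp_sum x (a+2) = 16 * (2*a+1) * (2*a+3) * hyp_sum x a"
proof -
  have a2: "2 * (a + 2) \<notin> \<int>\<^sub>\<le>\<^sub>0"
    using a nonpos_Ints_diff_Nats[of "2 * (a + 2)" 4] by auto
  let ?A = "(3+x) * (5*a+4) * (5*a+6)"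
  let ?B = "16 * (2*a+1) * (2*a+3)"
  have "(\<lambda>k. ?A * hyp_term x (a+2) k - ?B * hyp_term x a k) sums (?A * hyp_sum x (a+2) - ?B * hyp_sum x a)"
    unfolding hyp_sum_def using assms a2
    by (intro sums_diff sums_mult summable_sums summable_hyp_term)
  moreover have "(\<lambda>k. ?A * hyp_term x (a+2) k - ?B * hyp_term x a k) sums 0"
    using wz_remainder_tendsto_0[OF assms(2,3)]
    unfolding sums_def_le hyp_term_telescope[OF assms(1) pochhammer_double_nz[OF a]] .
  ultimately show ?thesis using sums_unique2 by fastforce
qed

text \<open>
  If \<open>a\<close> is a negative integer, \<open>pochhammer (2*a) k\<close> vanishes for large \<open>k\<close>, but by then
  \<open>pochhammer a k = 0\<close>, so with \<open>0 / 0 = 0\<close> the infinite sum is the conventional truncated sum.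
\<close>

lemma hyp_sum_eq_sum:
  fixes x a :: "'a::{real_normed_field,banach}"
  assumes "a = - of_nat m \<or> 1 - a/2 = - of_nat m"
  shows "hyp_sum x a = (\<Sum>k\<le>m. hyp_term x a k)"
  unfolding hyp_sum_def
  by (rule suminf_finite) (use assms in \<open>auto simp: hyp_term_def pochhammer_of_nat_eq_0_iff\<close>)

text \<open>
  The bound \<open>m \<ge> 4\<close> keeps \<open>pochhammer (2*a) (m+4)\<close> nonzero, for \<open>2a = -2m\<close>; the smallest values are
  computed directly.
\<close>

lemma hyp_sum_recurrence_terminating:
  fixes x :: "'a::{real_normed_field,banach}"
  assumes x: "x^2 = 1 - x" and m: "m \<ge> 4" and a: "a = - of_nat m"
  shows "(3+x) * (5*a+4) * (5*a+6) * hyp_sum x (a+2) = 16 * (2*a+1) * (2*a+3) * hyp_sum x a"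
proof -
  let ?A = "(3+x) * (5*a+4) * (5*a+6)"
  let ?B = "16 * (2*a+1) * (2*a+3)"
  have "2 * a = - of_nat (2*m)" by (simp add: a)
  then have "pochhammer (2*a) (m+4) \<noteq> 0"
    using m by (simp only: pochhammer_of_nat_eq_0_iff)
  from hyp_term_telescope[OF x this] have "?A * (\<Sum>k\<le>m. hyp_term x (a+2) k) - ?B * (\<Sum>k\<le>m. hyp_term x a k) = 0"
    by (simp add: wz_remainder_def a sum_subtractf sum_distrib_left)
  moreover have "(\<Sum>k\<le>m. hyp_term x (a+2) k) = (\<Sum>k\<le>m-2. hyp_term x (a+2) k)"
  proof (rule sum.mono_neutral_right)
    have "a + 2 = - of_nat (m - 2)" using m by (simp add: a of_nat_diff)
    then show "\<forall>k\<in>{..m} - {..m - 2}. hyp_term x (a+2) k = 0"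
      by (auto simp: hyp_term_def pochhammer_of_nat_eq_0_iff)
  qed auto
  moreover have "a + 2 = - of_nat (m - 2)" using m by (simp add: a of_nat_diff)
  ultimately show ?thesis using hyp_sum_eq_sum[of a m] hyp_sum_eq_sum[of "a+2" "m-2"] a by simp
qed

section \<open>Negative integers: the terminating sums\<close>

lemma gauss_hypergeo_eq_hyp_sum:
  assumes "2 * a \<notin> \<int>\<^sub>\<le>\<^sub>0"
  shows "gauss_hypergeo a (1 - a/2) (2*a) x = hyp_sum x a"
proof -
  have "\<not> (a \<in> \<int>\<^sub>\<le>\<^sub>0 \<and> 2 * a \<in> \<int>\<^sub>\<le>\<^sub>0 \<and> Re (2 * a) < Re a)" using assms by simp
  then show ?thesis unfolding gauss_hypergeo_def hyp_sum_def hyp_term_def by (simp only: if_False)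
qed

lemma gauss_hypergeo_neg_eq_hyp_sum:
  assumes "a = - of_nat m" "m > 0"
  shows "gauss_hypergeo a (1 - a/2) (2*a) x = hyp_sum x a"
proof -
  have "2 * a = - of_nat (2*m)" "m < 2*m" using assms by simp_all
  then show ?thesis
    using gauss_hypergeo_neg_int[of m "2*m" "1-a/2" x] hyp_sum_eq_sum[of a m x] assms(1)
    unfolding hyp_term_def by simp
qed

text \<open>
  The golden-ratio recurrence with \<open>3 + x = s (s + 1) / 2\<close> and \<open>s^4 = 25\<close> inserted.
\<close>

lemma hyp_sum_terminating_step:
  fixes s a :: complex
  assumes s: "s^2 = 5" and m: "m \<ge> 4" and a: "a = - of_nat m"
    and e: "5*a+4 = -10 * p" "5*a+6 = -10 * q" "2*a+1 = -4 * u" "2*a+3 = -4 * v"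
    and nz: "u \<noteq> 0" "v \<noteq> 0"
  shows "hyp_sum ((s-1)/2) a = s ^ 5 * (s+1) / 2 ^ 7 * (p * q / (u * v)) * hyp_sum ((s-1)/2) (a+2)"
proof -
  define x where "x = (s-1)/2"
  have x: "x^2 = 1 - x" using s by (simp add: x_def field_simps power2_eq_square)
  have s5: "s ^ 5 = 25 * s" using s by (simp add: eval_nat_numeral)
  have x3: "3 + x = s * (s+1) / 2" using s by (simp add: x_def field_simps power2_eq_square)
  have "s * (s+1) / 2 * (-10 * p) * (-10 * q) * hyp_sum x (a+2) = 16 * (-4 * u) * (-4 * v) * hyp_sum x a"
    using hyp_sum_recurrence_terminating[OF x m a] unfolding e x3 .
  then have "512 * (u * v * hyp_sum x a) = 100 * (p * q * (s * (s+1)) * hyp_sum x (a+2))"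
    by simp
  moreover have "X = 25 / 128 * Y" if "512 * X = 100 * Y" for X Y :: complex
    using that by (simp add: field_simps)
  ultimately have E: "u * v * hyp_sum x a = 25 / 128 * (p * q * (s * (s+1)) * hyp_sum x (a+2))"
    by blast
  have "hyp_sum x a = (u * v * hyp_sum x a) / (u * v)" using nz by simp
  also note E
  finally show ?thesis unfolding s5 x_def by simp
qed

lemma hyp_sum_minus_even:
  fixes s :: complex
  assumes s: "s^2 = 5"
  shows "hyp_sum ((s-1)/2) (- 2 - 2 * of_nat n) =
     s ^ (5*n+1) * (s+1) ^ (n+1) * pochhammer (8/5) n * pochhammer (7/5) n
       / (2 ^ (7*n+2) * pochhammer (7/4) n * pochhammer (5/4) n)"
proof (induction n)
  case 0
  have "hyp_sum ((s-1)/2) (-2) = (\<Sum>k\<le>2. hyp_term ((s-1)/2) (-2) k)"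
    by (rule hyp_sum_eq_sum) simp
  also have "\<dots> = s * (s+1) / 4"
    using s by (simp add: hyp_term_def eval_nat_numeral pochhammer_Suc field_simps power2_eq_square)
  finally show ?case by simp
next
  case (Suc n)
  define a :: complex where "a = - of_nat (2*n+4)"
  have e: "5*a+4 = -10 * (8/5 + of_nat n)" "5*a+6 = -10 * (7/5 + of_nat n)"
    "2*a+1 = -4 * (7/4 + of_nat n)" "2*a+3 = -4 * (5/4 + of_nat n)"
    by (simp_all add: a_def field_simps)
  have e': "a + 2 = - 2 - 2 * of_nat n" "a = - 2 - 2 * of_nat (Suc n)" by (simp_all add: a_def)
  have nz: "(7/4 :: complex) + of_nat n \<noteq> 0" "(5/4 :: complex) + of_nat n \<noteq> 0"
    by (auto simp: complex_eq_iff add_nonneg_eq_0_iff)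
  have "2*n+4 \<ge> 4" by simp
  from hyp_sum_terminating_step[OF s this a_def e nz]
  have "hyp_sum ((s-1)/2) (- 2 - 2 * of_nat (Suc n)) = s ^ 5 * (s+1) / 2 ^ 7 * ((8/5 + of_nat n) * (7/5 + of_nat n)
     / ((7/4 + of_nat n) * (5/4 + of_nat n))) * hyp_sum ((s-1)/2) (- 2 - 2 * of_nat n)"
    unfolding e'[symmetric] .
  moreover have "s ^ (5 * Suc n + 1) = s ^ 5 * s ^ (5*n+1)" "(2::complex) ^ (7 * Suc n + 2) = 2 ^ 7 * 2 ^ (7*n+2)"
    unfolding power_add[symmetric] by (simp_all add: algebra_simps)
  ultimately show ?case
    unfolding Suc.IH pochhammer_Suc by (simp add: mult_ac)
qed

lemma hyp_sum_minus_odd: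
  fixes s :: complex
  assumes s: "s^2 = 5"
  shows "hyp_sum ((s-1)/2) (- 1 - 2 * of_nat n) =
     s ^ (5*n+1) * (s+1) ^ (n+2) * pochhammer (11/10) n * pochhammer (9/10) n
       / (2 ^ (7*n+4) * pochhammer (5/4) n * pochhammer (3/4) n)"
proof (induction n)
  case 0
  have "hyp_sum ((s-1)/2) (-1) = (\<Sum>k\<le>1. hyp_term ((s-1)/2) (-1) k)"
    by (rule hyp_sum_eq_sum) simp
  also have "\<dots> = s * (s+1)^2 / 16"
    using s by (simp add: hyp_term_def field_simps power2_eq_square)
  finally show ?case by (simp add: power2_eq_square)
next
  case (Suc n)
  define a :: complex where "a = - of_nat (2*n+3)"
  define x where "x = (s-1)/2"
  have x: "x^2 = 1 - x" using s by (simp add: x_def field_simps power2_eq_square)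
  have s5: "s ^ 5 = 25 * s" using s by (simp add: eval_nat_numeral)
  show ?case
  proof (cases "n = 0")
    case True
    have "hyp_sum ((s-1)/2) (-3) = (\<Sum>k\<le>3. hyp_term ((s-1)/2) (-3) k)"
      by (rule hyp_sum_eq_sum) simp
    also have "\<dots> = 1 + 5/4 * x + 7/8 * x^2 + 21/64 * x^3"
      by (simp add: hyp_term_def eval_nat_numeral pochhammer_Suc x_def)
    also have "x^3 = x * (1 - x)" using x by (simp add: power3_eq_cube power2_eq_square)
    also have "1 + 5/4 * x + 7/8 * x^2 + 21/64 * (x * (1 - x)) = 99/64 + x * 66/64 - (x^2 - (1 - x)) * (-35/64)"
      by (simp add: field_simps power2_eq_square)
    also have "x^2 - (1 - x) = 0" using x by simp
    also have "99/64 + x * 66/64 - 0 * (-35/64) = s ^ 5 * s * (s+1)^3 * (11/10) * (9/10) / (2 ^ 11 * (5/4) * (3/4))"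
    proof -
      have "s * s * s = 5 * s" using s by (simp add: power2_eq_square)
      then have s3: "(s+1)^3 = 8 * s + 16"
        using s by (simp add: power2_eq_square power3_eq_cube algebra_simps)
      have s6: "25 * s * s = 125" using s by (simp add: power2_eq_square)
      show ?thesis unfolding s5 s6 x_def s3 by (simp add: field_simps)
    qed
    finally show ?thesis using True by (simp add: eval_nat_numeral pochhammer_Suc)
  next
    case False
  have e: "5*a+4 = -10 * (11/10 + of_nat n)" "5*a+6 = -10 * (9/10 + of_nat n)"
    "2*a+1 = -4 * (5/4 + of_nat n)" "2*a+3 = -4 * (3/4 + of_nat n)"
    by (simp_all add: a_def field_simps)
  have e': "a + 2 = - 1 - 2 * of_nat n" "a = - 1 - 2 * of_nat (Suc n)" by (simp_all add: a_def)
  have nz: "(5/4 :: complex) + of_nat n \<noteq> 0" "(3/4 :: complex) + of_nat n \<noteq> 0"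
    by (auto simp: complex_eq_iff add_nonneg_eq_0_iff)
  have "2*n+3 \<ge> 4" using False by simp
  from hyp_sum_terminating_step[OF s this a_def e nz]
  have "hyp_sum ((s-1)/2) (- 1 - 2 * of_nat (Suc n)) = s ^ 5 * (s+1) / 2 ^ 7 * ((11/10 + of_nat n) * (9/10 + of_nat n)
     / ((5/4 + of_nat n) * (3/4 + of_nat n))) * hyp_sum ((s-1)/2) (- 1 - 2 * of_nat n)"
    unfolding e'[symmetric] .
  moreover have "s ^ (5 * Suc n + 1) = s ^ 5 * s ^ (5*n+1)" "(2::complex) ^ (7 * Suc n + 4) = 2 ^ 7 * 2 ^ (7*n+4)"
    unfolding power_add[symmetric] by (simp_all add: algebra_simps)
  ultimately show ?thesis
    unfolding Suc.IH pochhammer_Suc by (simp add: mult_ac)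
  qed
qed

section \<open>Euler integral and logarithmic convexity\<close>

lemma Beta_shift_left:
  fixes a b :: real
  assumes "a > 0" "b > 0"
  shows "Beta (a + of_nat k) b = Beta a b * pochhammer a k / pochhammer (a + b) k"
proof (induction k)
  case (Suc k)
  have nz: "pochhammer (a + b) k \<noteq> 0" "a + b + of_nat k \<noteq> 0"
    using assms by (auto simp: pochhammer_eq_0_iff add_nonneg_eq_0_iff)
  have "a + of_nat k + b \<notin> \<int>\<^sub>\<le>\<^sub>0" using assms by (auto dest!: nonpos_Ints_nonpos)
  then have "(a + of_nat k + b) * Beta (a + of_nat k + 1) b = (a + of_nat k) * Beta (a + of_nat k) b"
    using assms by (intro Beta_plus1_left) (auto dest!: nonpos_Ints_nonpos)
  then have "Beta (a + of_nat (Suc k)) b = (a + of_nat k) * Beta (a + of_nat k) b / (a + b + of_nat k)"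
    using nz by (simp add: field_simps)
  then show ?case unfolding Suc.IH pochhammer_Suc by (simp add: mult_ac)
qed simp

definition euler_kernel :: "real \<Rightarrow> real \<Rightarrow> real \<Rightarrow> real" where
  "euler_kernel x a t = t powr (a - 1) * (1 - t) powr (a - 1) * (1 - x * t) powr (a/2 - 1)"

definition euler_int :: "real \<Rightarrow> real \<Rightarrow> real" where
  "euler_int x a = Beta a a * hyp_sum x a"

text \<open>
  Expand \<open>(1 - x t) powr (a/2 - 1)\<close> by the binomial series and integrate termwise. As \<open>x < 1\<close>, the
  series converges absolutely and uniformly on the unit interval, so a multiple of the
  Beta integrand dominates all partial sums.
\<close>

lemma has_integral_euler_kernel:
  fixes x a :: real
  assumes x: "0 < x" "x < 1" and a: "a > 0"
  shows "(euler_kernel x a has_integral euler_int x a) {0..1}"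
proof -
  define e where "e = (\<lambda>k. pochhammer (1 - a/2) k / fact k * x ^ k)"
  define w where "w = (\<lambda>t::real. t powr (a - 1) * (1 - t) powr (a - 1))"
  have e_gb: "e k * t ^ k = ((a/2 - 1) gchoose k) * (- (x * t)) ^ k" for k t
    by (simp add: e_def gbinomial_pochhammer power_mult_distrib power_minus[of "x * t"] power_minus[of x])
  have sums_e: "(\<lambda>k. e k * t ^ k) sums (1 - x * t) powr (a/2 - 1)" if "t \<in> {0..1}" for t
  proof -
    have "x * t \<le> x * 1" using that x by (intro mult_left_mono) auto
    then have "x * t < 1" using x by linarith
    then have "\<bar>- (x * t)\<bar> < 1" using x that by simp
    from gen_binomial_real[OF this, of "a/2 - 1"] show ?thesis unfolding e_gb by simp
  qed
  have summable_e: "summable (\<lambda>k. \<bar>e k\<bar>)"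
  proof -
    obtain y where y: "x < y" "y < 1" using dense[OF x(2)] by blast
    have "(\<lambda>k. ((a/2 - 1) gchoose k) * (- y) ^ k) sums (1 + - y) powr (a/2 - 1)"
      using y x by (intro gen_binomial_real) auto
    then have "summable (\<lambda>k. ((a/2 - 1) gchoose k) * (- y) ^ k)" by (rule sums_summable)
    from powser_insidea[OF this, of "- x"] x y show ?thesis
      using e_gb[of _ 1] by simp
  qed
  define C where "C = (\<Sum>k. \<bar>e k\<bar>)"
  show ?thesis
  proof (rule has_integral_dominated_convergence)
    show "((\<lambda>t. w t * (\<Sum>k<N. e k * t ^ k)) has_integral (\<Sum>k<N. e k * Beta (a + of_nat k) a)) {0..1}" for N
    proof -
      have "((\<lambda>t. e k * (t powr (a + of_nat k - 1) * (1 - t) powr (a - 1))) has_integral e k * Beta (a + of_nat k) a) {0..1}" for k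
        using a by (intro has_integral_mult_right has_integral_Beta_real) auto
      then have "((\<lambda>t. \<Sum>k<N. e k * (t powr (a + of_nat k - 1) * (1 - t) powr (a - 1)))
                    has_integral (\<Sum>k<N. e k * Beta (a + of_nat k) a)) {0..1}"
        by (intro has_integral_sum) auto
      then show ?thesis
      proof (rule has_integral_eq[rotated])
        fix t :: real assume t: "t \<in> {0..1}"
        have "t powr (a + of_nat k - 1) = t powr (a - 1) * t ^ k" for k
        proof (cases "t = 0")
          case False
          then have "t powr ((a - 1) + of_nat k) = t powr (a - 1) * t ^ k"
            using t unfolding powr_add by (simp add: powr_realpow)
          then show ?thesis by (simp add: algebra_simps)
        qed simp
        then show "(\<Sum>k<N. e k * (t powr (a + of_nat k - 1) * (1 - t) powr (a - 1))) = w t * (\<Sum>k<N. e k * t ^ k)"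
          by (simp add: w_def sum_distrib_left mult_ac)
      qed
    qed
    show "(\<lambda>t. C * w t) integrable_on {0..1}"
      using has_integral_mult_right[OF has_integral_Beta_real[OF a a], of C]
      unfolding w_def by (rule has_integral_integrable)
    show "\<forall>t\<in>{0..1}. norm (w t * (\<Sum>k<N. e k * t ^ k)) \<le> C * w t" for N
    proof
      fix t :: real assume t: "t \<in> {0..1}"
      have "\<bar>\<Sum>k<N. e k * t ^ k\<bar> \<le> (\<Sum>k<N. \<bar>e k\<bar>)"
      proof (rule order_trans[OF sum_abs sum_mono])
        show "\<bar>e k * t ^ k\<bar> \<le> \<bar>e k\<bar>" for k
          using t power_le_one[of t k] by (simp add: abs_mult mult_left_le)
      qed
      also have "\<dots> \<le> C"
        unfolding C_def using summable_e by (intro sum_le_suminf) auto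
      finally have "w t * \<bar>\<Sum>k<N. e k * t ^ k\<bar> \<le> w t * C"
        by (intro mult_left_mono) (auto simp: w_def)
      then show "norm (w t * (\<Sum>k<N. e k * t ^ k)) \<le> C * w t"
        by (simp add: abs_mult w_def mult_ac)
    qed
    show "\<forall>t\<in>{0..1}. (\<lambda>N. w t * (\<Sum>k<N. e k * t ^ k)) \<longlonglongrightarrow> euler_kernel x a t"
      using sums_e unfolding euler_kernel_def w_def sums_def by (auto intro!: tendsto_intros)
    have "e k * Beta (a + of_nat k) a = Beta a a * hyp_term x a k" for k
      by (simp add: Beta_shift_left[OF a a] e_def hyp_term_def pochhammer_fact[symmetric] mult_ac flip: mult_2)
    moreover have "hyp_term x a sums hyp_sum x a"
      unfolding hyp_sum_def using x a
      by (intro summable_sums summable_hyp_term) (auto dest!: nonpos_Ints_nonpos)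
    ultimately show "(\<lambda>N. \<Sum>k<N. e k * Beta (a + of_nat k) a) \<longlonglongrightarrow> euler_int x a"
      unfolding euler_int_def by (simp add: sums_def sum_distrib_left[symmetric] tendsto_mult_left)
  qed
qed

lemma euler_kernel_shift:
  fixes x :: real
  assumes x: "0 < x" "x < 1" and t: "t \<in> {0..1}"
  shows "euler_kernel x (a + 2 * \<theta>) t = euler_kernel x a t * (t^2 * (1-t)^2 * (1 - x*t)) powr \<theta>"
proof (cases "t = 0 \<or> t = 1")
  case False
  then have t: "0 < t" "t < 1" using t by auto
  have "x * t < 1 * 1" using x t by (intro mult_strict_mono) auto
  then have xt: "1 - x * t > 0" by simp
  have sq: "u powr (a + 2 * \<theta> - 1) = u powr (a - 1) * (u^2) powr \<theta>" if "u > 0" for u :: real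
  proof -
    have "u^2 = u powr 2" using that by simp
    then have "(u^2) powr \<theta> = u powr (2 * \<theta>)" by (simp only: powr_powr)
    then show ?thesis by (simp add: powr_add[symmetric] algebra_simps)
  qed
  have "(1 - x*t) powr ((a + 2 * \<theta>)/2 - 1) = (1 - x*t) powr (a/2 - 1) * (1 - x*t) powr \<theta>"
    by (simp add: powr_add[symmetric] add_divide_distrib algebra_simps)
  then show ?thesis
    unfolding euler_kernel_def using sq[of t] sq[of "1-t"] t xt by (simp add: powr_mult)
qed (auto simp: euler_kernel_def)

text \<open>
  This is the log-convexity of \<open>a \<mapsto> euler_int x a\<close> in a linearised form: integrate the weighted
  inequality \<open>(W/r) powr \<theta> \<le> (1 - \<theta>) + \<theta> W/r\<close> against the kernel. The free parameter
  \<open>r\<close> avoids any appeal to Hoelder's inequality.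
\<close>

lemma euler_int_shift_le:
  fixes x :: real
  assumes x: "0 < x" "x < 1" and a: "a > 0" and \<theta>: "0 \<le> \<theta>" "\<theta> \<le> 1" and r: "r > 0"
  shows "euler_int x (a + 2 * \<theta>) \<le> r powr \<theta> * ((1 - \<theta>) * euler_int x a + \<theta> * euler_int x (a + 2) / r)"
proof (rule has_integral_le)
  show "(euler_kernel x (a + 2*\<theta>) has_integral euler_int x (a + 2*\<theta>)) {0..1}"
    using assms by (intro has_integral_euler_kernel) auto
  show "((\<lambda>t. r powr \<theta> * ((1 - \<theta>) * euler_kernel x a t + \<theta> * euler_kernel x (a+2) t / r)) has_integral
     r powr \<theta> * ((1 - \<theta>) * euler_int x a + \<theta> * euler_int x (a + 2) / r)) {0..1}"
    using assms by (intro has_integral_mult_right has_integral_add has_integral_divide has_integral_euler_kernel) auto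
  fix t :: real assume t: "t \<in> {0..1}"
  define W where "W = t^2 * (1-t)^2 * (1 - x*t)"
  have W0: "W \<ge> 0"
  proof -
    have "x * t \<le> 1 * 1" using x t by (intro mult_mono) auto
    then show ?thesis by (simp add: W_def)
  qed
  have k0: "euler_kernel x a t \<ge> 0" by (simp add: euler_kernel_def)
  have W1: "euler_kernel x (a+2) t = euler_kernel x a t * W"
    using euler_kernel_shift[OF x t, of a 1] W0 by (simp add: W_def)
  have "W powr \<theta> \<le> r powr \<theta> * ((1 - \<theta>) + \<theta> * W / r)"
  proof (cases "W = 0")
    case False
    have "(W / r) powr \<theta> * 1 powr (1 - \<theta>) \<le> \<theta> * (W / r) + (1 - \<theta>) * 1"
      using False W0 r \<theta> by (intro Youngs_inequality_0) auto
    then have "r powr \<theta> * (W / r) powr \<theta> \<le> r powr \<theta> * ((1 - \<theta>) + \<theta> * W / r)"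
      by (intro mult_left_mono) auto
    also have "r powr \<theta> * (W / r) powr \<theta> = W powr \<theta>"
      using W0 r by (simp add: powr_divide)
    finally show ?thesis .
  qed (use \<theta> in auto)
  then have "euler_kernel x a t * W powr \<theta> \<le> euler_kernel x a t * (r powr \<theta> * ((1 - \<theta>) + \<theta> * W / r))"
    by (rule mult_left_mono[OF _ k0])
  then show "euler_kernel x (a + 2*\<theta>) t \<le> r powr \<theta> * ((1 - \<theta>) * euler_kernel x a t + \<theta> * euler_kernel x (a+2) t / r)"
    unfolding W1 euler_kernel_shift[OF x t, folded W_def] by (simp add: algebra_simps)
qed

definition step_ratio :: "real \<Rightarrow> real \<Rightarrow> real" where
  "step_ratio x a = 4 * a * (a + 1) / ((3+x) * (5*a+4) * (5*a+6))"

lemma euler_int_recurrence: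
  fixes x :: real
  assumes x: "x^2 = 1 - x" "0 < x" "x < 1" and a: "a > 0"
  shows "euler_int x (a + 2) = step_ratio x a * euler_int x a"
proof -
  have nonpole: "a \<notin> \<int>\<^sub>\<le>\<^sub>0" "2 * a \<notin> \<int>\<^sub>\<le>\<^sub>0" using a by (auto dest!: nonpos_Ints_nonpos)
  moreover have "Gamma a \<noteq> 0" "Gamma (2 * a) \<noteq> 0" using nonpole by (simp_all add: Gamma_eq_zero_iff)
  ultimately have "Gamma (2 * a + 4) = pochhammer (2*a) 4 * Gamma (2 * a)"
       "Gamma (a + 2) = pochhammer a 2 * Gamma a"
    using pochhammer_Gamma[of "2*a" 4] pochhammer_Gamma[of a 2] by (simp_all add: field_simps)
  then have B: "Beta (a + 2) (a + 2) = pochhammer a 2 ^ 2 / pochhammer (2*a) 4 * Beta a a"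
    unfolding Beta_def by (simp add: power2_eq_square)
  from nonpole hyp_sum_recurrence[of x a] x have "(3+x) * (5*a+4) * (5*a+6) * hyp_sum x (a+2) = 16 * (2*a+1) * (2*a+3) * hyp_sum x a"
    by simp
  moreover define D where "D = (3+x) * (5*a+4) * (5*a+6)"
  moreover have "D \<noteq> 0" using x a by (simp add: D_def)
  ultimately have rec: "hyp_sum x (a+2) = 16 * (2*a+1) * (2*a+3) / D * hyp_sum x a"
    by (simp add: eq_divide_eq mult_ac)
  have coef: "pochhammer a 2 ^ 2 / pochhammer (2*a) 4 * (16 * (2*a+1) * (2*a+3) / D) = 4 * a * (a+1) / D"
  proof -
    define P Q where "P = a * (a+1)" and "Q = (2*a+1) * (2*a+3)"
    have "P \<noteq> 0" "Q \<noteq> 0" using a by (auto simp: P_def Q_def)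
    moreover have "pochhammer (2*a) 4 = 4 * P * Q" "pochhammer a 2 = P"
      unfolding pochhammer_4 pochhammer_2 P_def Q_def by (simp_all add: algebra_simps)
    moreover have "16 * (2*a+1) * (2*a+3) = 16 * Q" "4 * a * (a+1) = 4 * P"
      by (simp_all add: P_def Q_def)
    ultimately show ?thesis by (simp add: power2_eq_square)
  qed
  have "euler_int x (a+2) = pochhammer a 2 ^ 2 / pochhammer (2*a) 4 * (16 * (2*a+1) * (2*a+3) / D)
      * (Beta a a * hyp_sum x a)"
    unfolding euler_int_def B rec by (simp only: mult_ac)
  then show ?thesis unfolding coef unfolding step_ratio_def euler_int_def D_def .
qed

definition limit_ratio :: "real \<Rightarrow> real" where
  "limit_ratio x = 4 / (25 * (3 + x))"

lemma step_ratio_pos: "0 < x \<Longrightarrow> 0 < a \<Longrightarrow> step_ratio x a > 0"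
  by (simp add: step_ratio_def)

text \<open>
  In the variable \<open>z = a/2\<close> the step ratio is the one of
  \<open>limit_ratio x powr z * Gamma z * Gamma (z + 1/2) / (Gamma (z + 2/5) * Gamma (z + 3/5))\<close>.
\<close>

lemma step_ratio_double:
  "step_ratio x (2 * z) = limit_ratio x * (z * (z + 1/2) / ((z + 2/5) * (z + 3/5)))"
proof -
  have "4 * (2 * z) * (2 * z + 1) = 16 * (z * (z + 1/2))"
       "(3+x) * (5*(2*z)+4) * (5*(2*z)+6) = 4 * (25 * (3+x)) * ((z + 2/5) * (z + 3/5))"
    by (simp_all add: field_simps)
  moreover have "16 * P / (4 * E * Q) = 4 / E * (P / Q)" for P Q E :: real
    by simp
  ultimately show ?thesis unfolding step_ratio_def limit_ratio_def by metis
qed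

lemma step_ratio_tendsto:
  "(\<lambda>N. step_ratio x (2 * (of_nat N + c))) \<longlonglongrightarrow> limit_ratio x"
proof -
  have "(\<lambda>N. limit_ratio x * ((of_nat N + c) / (of_nat N + (c + 2/5)) * ((of_nat N + (c + 1/2)) / (of_nat N + (c + 3/5)))))
          \<longlonglongrightarrow> limit_ratio x * (1 * 1)"
    by (intro tendsto_intros tendsto_of_nat_add_ratio)
  then show ?thesis unfolding step_ratio_double by (simp add: add.assoc)
qed

lemma euler_int_even_pos:
  fixes x :: real
  assumes "x^2 = 1 - x" "0 < x" "x < 1"
  shows "euler_int x (2 * (of_nat N + 1)) > 0"
proof (induction N)
  case 0
  have "hyp_sum x 2 = (\<Sum>k\<le>0. hyp_term x 2 k)" by (rule hyp_sum_eq_sum) simp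
  then show ?case by (simp add: hyp_term_def euler_int_def Beta_def)
next
  case (Suc N)
  have "2 * (real (Suc N) + 1) = 2 * (of_nat N + 1) + 2" by simp
  then show ?case
    using euler_int_recurrence[OF assms, of "2 * (of_nat N + 1)"] Suc step_ratio_pos[of x "2 * (of_nat N + 1)"] assms
    by simp
qed

text \<open>
  The Bohr-Mollerup argument. Taking \<open>r = R b\<close>, the exact step ratio, in \<open>euler_int_shift_le\<close>
  collapses the bound to \<open>G (b + 2\<eta>) \<le> R b powr \<eta> * G b\<close>. Used from \<open>b = a\<close> with \<open>\<eta> = \<theta>\<close> it bounds
  \<open>G (a + 2\<theta>)\<close> above, and used from \<open>b = a + 2\<theta>\<close> with \<open>\<eta> = 1 - \<theta>\<close>, where it reaches \<open>G (a + 2)\<close>, it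
  bounds \<open>G (a + 2\<theta>)\<close> below. Both bounds converge to the same limit.
\<close>

lemma euler_int_ratio_tendsto:
  fixes x :: real
  assumes x: "x^2 = 1 - x" "0 < x" "x < 1" and \<theta>: "0 \<le> \<theta>" "\<theta> \<le> 1"
  shows "(\<lambda>N. euler_int x (2 * (of_nat N + 1 + \<theta>)) / euler_int x (2 * (of_nat N + 1))) \<longlonglongrightarrow> limit_ratio x powr \<theta>"
proof (rule tendsto_sandwich)
  define R where "R = step_ratio x"
  define a where "a = (\<lambda>N. 2 * (real N + 1))"
  have a0: "a N > 0" for N by (simp add: a_def)
  have G0: "euler_int x (a N) > 0" for N unfolding a_def by (rule euler_int_even_pos[OF x])
  have R0: "R b > 0" if "b > 0" for b using step_ratio_pos that x by (simp add: R_def)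
  have rec: "euler_int x (b + 2) = R b * euler_int x b" if "b > 0" for b
    unfolding R_def by (rule euler_int_recurrence[OF x that])
  have upper: "euler_int x (b + 2 * \<eta>) \<le> R b powr \<eta> * euler_int x b" if "b > 0" "0 \<le> \<eta>" "\<eta> \<le> 1" for b \<eta>
    using euler_int_shift_le[OF x(2,3) that R0[OF that(1)]] R0[OF that(1)]
    unfolding rec[OF that(1)] by (simp add: algebra_simps)
  have eq: "2 * (real N + 1 + \<theta>) = a N + 2 * \<theta>" "2 * (real N + 1) = a N" for N
    by (simp_all add: a_def)
  show "\<forall>\<^sub>F N in sequentially. euler_int x (2 * (real N + 1 + \<theta>)) / euler_int x (2 * (real N + 1)) \<le> R (2 * (real N + 1)) powr \<theta>"
    using upper[OF a0 \<theta>] G0 unfolding eq by (simp add: pos_divide_le_eq)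
  show "\<forall>\<^sub>F N in sequentially. R (2 * (real N + 1)) / R (2 * (real N + (1 + \<theta>))) powr (1 - \<theta>)
            \<le> euler_int x (2 * (real N + 1 + \<theta>)) / euler_int x (2 * (real N + 1))"
  proof (intro always_eventually allI)
    fix N
    have b: "a N + 2 * \<theta> > 0" using a0[of N] \<theta> by simp
    have "R (a N) * euler_int x (a N) \<le> R (a N + 2 * \<theta>) powr (1 - \<theta>) * euler_int x (a N + 2 * \<theta>)"
      using upper[OF b, of "1 - \<theta>"] \<theta> rec[OF a0] by (simp add: algebra_simps)
    moreover have "R (a N + 2 * \<theta>) powr (1 - \<theta>) > 0" using R0[OF b] by simp
    ultimately have "R (a N) / R (a N + 2 * \<theta>) powr (1 - \<theta>) \<le> euler_int x (a N + 2 * \<theta>) / euler_int x (a N)"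
      using G0[of N] by (simp add: divide_simps mult_ac)
    then show "R (2 * (real N + 1)) / R (2 * (real N + (1 + \<theta>))) powr (1 - \<theta>)
            \<le> euler_int x (2 * (real N + 1 + \<theta>)) / euler_int x (2 * (real N + 1))"
      by (simp add: a_def algebra_simps)
  qed
  have lim: "limit_ratio x > 0" using x by (simp add: limit_ratio_def)
  show "(\<lambda>N. R (2 * (real N + 1)) powr \<theta>) \<longlonglongrightarrow> limit_ratio x powr \<theta>"
    unfolding R_def using lim by (intro tendsto_powr step_ratio_tendsto tendsto_const) auto
  have "(\<lambda>N. R (2 * (real N + 1)) / R (2 * (real N + (1 + \<theta>))) powr (1 - \<theta>)) \<longlonglongrightarrow> limit_ratio x / limit_ratio x powr (1 - \<theta>)"
    unfolding R_def using lim by (intro tendsto_divide tendsto_powr step_ratio_tendsto tendsto_const) auto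
  also have "limit_ratio x / limit_ratio x powr (1 - \<theta>) = limit_ratio x powr \<theta>"
    using lim by (simp add: powr_diff)
  finally show "(\<lambda>N. R (2 * (real N + 1)) / R (2 * (real N + (1 + \<theta>))) powr (1 - \<theta>)) \<longlonglongrightarrow> limit_ratio x powr \<theta>" .
qed

definition gamma_quot :: "real \<Rightarrow> real" where
  "gamma_quot z = Gamma z * Gamma (z + 1/2) / (Gamma (z + 2/5) * Gamma (z + 3/5))"

lemma euler_int_iterate:
  fixes x :: real
  assumes x: "x^2 = 1 - x" "0 < x" "x < 1" and z: "z > 0"
  shows "euler_int x (2 * (z + of_nat n)) = euler_int x (2 * z) * limit_ratio x ^ n
     * (pochhammer z n * pochhammer (z + 1/2) n / (pochhammer (z + 2/5) n * pochhammer (z + 3/5) n))"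
proof (induction n)
  case (Suc n)
  have "euler_int x (2 * (z + of_nat n) + 2) = step_ratio x (2 * (z + of_nat n)) * euler_int x (2 * (z + of_nat n))"
    using z by (intro euler_int_recurrence x) auto
  moreover have "2 * (z + of_nat n) + 2 = 2 * (z + of_nat (Suc n))" by simp
  ultimately show ?case
    unfolding Suc.IH step_ratio_double pochhammer_Suc by (simp add: add_ac mult_ac)
qed simp

text \<open>
  The Pochhammer symbols in the iterated recurrence are those of Euler's limit formula for the
  four Gamma values. The powers of \<open>n\<close> combine to \<open>n powr (1/2)\<close>, independently of \<open>z\<close>, because
  \<open>z + (z + 1/2)\<close> and \<open>(z + 2/5) + (z + 3/5)\<close> differ by \<open>1/2\<close>; so the limits for different \<open>z\<close> can be
  compared.
\<close>

lemma euler_int_normalised_tendsto: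
  fixes x :: real
  assumes x: "x^2 = 1 - x" "0 < x" "x < 1" and z: "z > 0"
  shows "(\<lambda>n. euler_int x (2 * (z + of_nat (n + 1))) / limit_ratio x ^ (n + 1) * exp (ln (of_nat n) / 2))
           \<longlonglongrightarrow> euler_int x (2 * z) / gamma_quot z"
proof -
  have "(\<lambda>n. euler_int x (2 * z) * (Gamma_series (z + 2/5) n * Gamma_series (z + 3/5) n
             / (Gamma_series z n * Gamma_series (z + 1/2) n)))
        \<longlonglongrightarrow> euler_int x (2 * z) * (Gamma (z + 2/5) * Gamma (z + 3/5) / (Gamma z * Gamma (z + 1/2)))"
    using less_imp_neq[OF Gamma_real_pos[of z]] less_imp_neq[OF Gamma_real_pos[of "z + 1/2"]] z
    by (intro tendsto_intros) simp
  moreover have "euler_int x (2 * z) * (Gamma_series (z + 2/5) n * Gamma_series (z + 3/5) n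
             / (Gamma_series z n * Gamma_series (z + 1/2) n))
        = euler_int x (2 * (z + of_nat (n + 1))) / limit_ratio x ^ (n + 1) * exp (ln (of_nat n) / 2)" for n
  proof -
    define L where "L = ln (real n)"
    have "exp ((z + 2/5) * L) * exp ((z + 3/5) * L) = exp (z * L) * exp ((z + 1/2) * L) * exp (L / 2)"
      unfolding exp_add[symmetric] by (simp add: algebra_simps)
    moreover define A B C D where "A = exp ((z + 2/5) * L)" and "B = exp ((z + 3/5) * L)"
       and "C = exp (z * L)" and "D = exp ((z + 1/2) * L)"
    ultimately have AB: "exp (L / 2) = A * B / (C * D)" by (simp add: field_simps)
    have nz: "C \<noteq> 0" "D \<noteq> 0" "limit_ratio x \<noteq> 0" using x by (auto simp: C_def D_def limit_ratio_def)
    have pnz: "pochhammer b m \<noteq> 0" if "b > 0" for b :: real and m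
      using pochhammer_pos[OF that, of m] by simp
    show ?thesis
      unfolding euler_int_iterate[OF x z] Gamma_series_def L_def[symmetric] AB A_def[symmetric] B_def[symmetric]
         C_def[symmetric] D_def[symmetric] of_real_eq_id id_apply
      using nz z pnz[of z "n+1"] pnz[of "z + 1/2" "n+1"] pnz[of "z + 2/5" "n+1"] pnz[of "z + 3/5" "n+1"]
      by (simp add: field_simps del: pochhammer_Suc Suc_eq_plus1 power_Suc)
  qed
  ultimately show ?thesis by (simp add: gamma_quot_def)
qed

text \<open>
  The quotient \<open>h z n / h 1 n\<close> has two limits: one from the recurrence, through the Gamma function,
  and one from log-convexity.
\<close>

lemma euler_int_closed_form:
  fixes x :: real
  assumes x: "x^2 = 1 - x" "0 < x" "x < 1" and z: "0 < z" "z \<le> 1"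
  shows "euler_int x (2 * z) = euler_int x 2 * limit_ratio x powr (z - 1) * gamma_quot z / gamma_quot 1"
proof -
  define r where "r = limit_ratio x"
  define g where "g = (\<lambda>z. euler_int x (2 * z))"
  have r: "r > 0" using x by (simp add: r_def limit_ratio_def)
  have K: "gamma_quot z > 0" if "z > 0" for z using that by (simp add: gamma_quot_def)
  have g: "g (real N + 1) > 0" for N unfolding g_def using euler_int_even_pos[OF x] .
  have lim: "(\<lambda>N. g (real N + 1 + \<theta>) / g (real N + 1)) \<longlonglongrightarrow> r powr \<theta>" if "0 \<le> \<theta>" "\<theta> \<le> 1" for \<theta>
    unfolding g_def r_def by (rule euler_int_ratio_tendsto[OF x that])
  define h where "h = (\<lambda>z n. g (z + of_nat (n + 1)) / r ^ (n + 1) * exp (ln (real n) / 2))"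
  have h: "h z \<longlonglongrightarrow> g z / gamma_quot z" if "z > 0" for z
    unfolding h_def g_def r_def by (rule euler_int_normalised_tendsto[OF x that])
  have "g 1 > 0" using g[of 0] by simp
  then have "(\<lambda>n. h z n / h 1 n) \<longlonglongrightarrow> (g z / gamma_quot z) / (g 1 / gamma_quot 1)"
    using z K[of 1] by (intro tendsto_divide h) auto
  moreover have "(\<lambda>n. h z n / h 1 n) \<longlonglongrightarrow> r powr (z - 1)"
  proof -
    have "(\<lambda>n. (g (real n + 1 + z) / g (real n + 1)) / (g (real n + 1 + 1) / g (real n + 1))) \<longlonglongrightarrow> r powr z / r powr 1"
      using z r by (intro tendsto_divide lim) auto
    moreover have "(g (real n + 1 + z) / g (real n + 1)) / (g (real n + 1 + 1) / g (real n + 1)) = h z n / h 1 n" for n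
      using g[of n] r unfolding h_def by (simp add: add_ac)
    ultimately show ?thesis using r by (simp add: powr_diff)
  qed
  ultimately have "(g z / gamma_quot z) / (g 1 / gamma_quot 1) = r powr (z - 1)"
    by (rule LIMSEQ_unique)
  then show ?thesis
    using K[OF z(1)] K[of 1] \<open>g 1 > 0\<close> by (simp add: field_simps g_def r_def)
qed

section \<open>From the real interval to the complex plane\<close>

lemma Gamma_duplication_real:
  fixes z :: real
  assumes "z > 0"
  shows "Gamma z * Gamma (z + 1/2) = 2 powr (1 - 2*z) * sqrt pi * Gamma (2*z)"
proof -
  have "complex_of_real z \<notin> \<int>\<^sub>\<le>\<^sub>0" "complex_of_real (z + 1/2) \<notin> \<int>\<^sub>\<le>\<^sub>0"
    using assms unfolding of_real_in_nonpos_Ints_iff by (auto dest!: nonpos_Ints_nonpos)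
  then have "complex_of_real (Gamma z * Gamma (z + 1/2)) = of_real (exp ((1 - 2*z) * ln 2) * sqrt pi * Gamma (2*z))"
    using Gamma_legendre_duplication[of "of_real z"]
    by (simp flip: Gamma_complex_of_real exp_of_real)
  then show ?thesis unfolding of_real_eq_iff by (simp add: powr_def)
qed

text \<open>
  Two applications of Legendre's duplication formula, to \<open>Gamma (4z)\<close> and to \<open>Gamma (2z)\<close>; the factors
  \<open>Gamma z * Gamma (z + 1/2)\<close> cancel against those in \<open>gamma_quot\<close>.
\<close>

lemma Beta_diag:
  fixes z :: real
  assumes z: "z > 0"
  shows "Beta (2*z) (2*z) = Gamma z * Gamma (z + 1/2) / (4 powr z * Gamma (2*z + 1/2))"
proof -
  have nz: "Gamma (2*z + 1/2) \<noteq> 0" "Gamma (4*z) \<noteq> 0"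
    using Gamma_real_pos[of "2*z + 1/2"] Gamma_real_pos[of "4*z"] z by linarith+
  have p: "2 powr (1 - 2 * (2*z)) = 2 powr (1 - 2*z) / 4 powr z"
  proof -
    have "4 powr z = (2 powr 2) powr z" by simp
    also have "\<dots> = 2 powr (2 * z)" by (simp only: powr_powr)
    finally show ?thesis by (simp add: powr_diff[symmetric])
  qed
  have "Beta (2*z) (2*z) * Gamma (2*z + 1/2) = Gamma (2*z) * (Gamma (2*z) * Gamma (2*z + 1/2)) / Gamma (4*z)"
    by (simp add: Beta_def)
  also have "\<dots> = Gamma (2*z) * (2 powr (1 - 2*z) / 4 powr z * sqrt pi)"
    using Gamma_duplication_real[of "2*z"] z nz unfolding p by simp
  also have "\<dots> = Gamma z * Gamma (z + 1/2) / 4 powr z"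
    using Gamma_duplication_real[OF z] by simp
  finally show ?thesis using nz by (simp add: field_simps)
qed

definition gamma_side :: "real \<Rightarrow> complex \<Rightarrow> complex" where
  "gamma_side x a = exp (a / 2 * of_real (ln (4 * limit_ratio x)))
     * Gamma (a + 1/2) * rGamma (a/2 + 2/5) * rGamma (a/2 + 3/5)"

text \<open>
  The normalisation is fixed by the trivial value \<open>f 2 = F (2, 0; 4; x) = 1\<close>, that is
  \<open>euler_int x 2 = Beta 2 2 = 1/6\<close>.
\<close>

definition gamma_const :: "real \<Rightarrow> real" where
  "gamma_const x = 1 / (6 * limit_ratio x * gamma_quot 1)"

lemma hyp_sum_of_real:
  assumes "\<bar>x\<bar> < 1" "2 * a \<notin> \<int>\<^sub>\<le>\<^sub>0"
  shows "hyp_sum (of_real x) (of_real a) = complex_of_real (hyp_sum x a)"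
proof -
  have "hyp_term x a sums hyp_sum x a" unfolding hyp_sum_def
    using assms by (intro summable_sums summable_hyp_term) auto
  then have "(\<lambda>k. complex_of_real (hyp_term x a k)) sums of_real (hyp_sum x a)" by (simp only: sums_of_real_iff)
  moreover have "complex_of_real (hyp_term x a k) = hyp_term (of_real x) (of_real a) k" for k
    by (simp add: hyp_term_def flip: pochhammer_of_real)
  ultimately show ?thesis unfolding hyp_sum_def by (simp add: sums_iff)
qed

lemma hyp_sum_real_closed_form:
  fixes x :: real
  assumes x: "x^2 = 1 - x" "0 < x" "x < 1" and a: "0 < a" "a \<le> 2"
  shows "hyp_sum (of_real x) (of_real a) = of_real (gamma_const x) * gamma_side x (of_real a)"
proof -
  define z where "z = a / 2"
  have z: "0 < z" "z \<le> 1" "a = 2 * z" using a by (auto simp: z_def)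
  define r where "r = limit_ratio x"
  have r: "r > 0" using x by (simp add: r_def limit_ratio_def)
  have E2: "euler_int x 2 = 1/6"
  proof -
    have "hyp_sum x 2 = (\<Sum>k\<le>0. hyp_term x 2 k)" by (rule hyp_sum_eq_sum) simp
    moreover have "Beta 2 2 = (1/6 :: real)" by (simp add: Beta_def Gamma_numeral eval_nat_numeral)
    ultimately show ?thesis by (simp add: euler_int_def hyp_term_def)
  qed
  have pos: "Gamma z > 0" "Gamma (z + 1/2) > 0" "Gamma (2*z + 1/2) > 0" "Gamma (z + 2/5) > 0" "Gamma (z + 3/5) > 0"
    "gamma_quot 1 > 0" using z by (auto simp: gamma_quot_def)
  have "hyp_sum x (2*z) = euler_int x (2*z) / Beta (2*z) (2*z)"
    using pos unfolding euler_int_def Beta_diag[OF z(1)] by simp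
  also have "\<dots> = 1/6 * r powr (z - 1) / gamma_quot 1 * (4 powr z * Gamma (2*z + 1/2) / (Gamma (z + 2/5) * Gamma (z + 3/5)))"
    using pos unfolding euler_int_closed_form[OF x z(1,2)] E2 Beta_diag[OF z(1)] gamma_quot_def[of z] r_def[symmetric]
    by simp
  also have "\<dots> = gamma_const x * ((4 * r) powr z * Gamma (2*z + 1/2) * rGamma (z + 2/5) * rGamma (z + 3/5))"
    using r by (simp add: gamma_const_def r_def[symmetric] powr_mult powr_diff rGamma_inverse_Gamma field_simps)
  finally have "hyp_sum x a = gamma_const x * ((4 * r) powr z * Gamma (2*z + 1/2) * rGamma (z + 2/5) * rGamma (z + 3/5))"
    unfolding z(3) .
  moreover have "hyp_sum (of_real x) (of_real a) = complex_of_real (hyp_sum x a)"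
    using x a by (intro hyp_sum_of_real) (auto dest!: nonpos_Ints_nonpos)
  moreover have "gamma_side x (of_real a) = of_real ((4 * r) powr z * Gamma (2*z + 1/2) * rGamma (z + 2/5) * rGamma (z + 3/5))"
    using r unfolding gamma_side_def z(3) r_def[symmetric]
    by (simp add: powr_def flip: Gamma_complex_of_real rGamma_complex_of_real exp_of_real)
  ultimately show ?thesis by simp
qed

lemma norm_pochhammer_le:
  fixes z :: "'a::{real_normed_field}"
  assumes "norm z \<le> b"
  shows "norm (pochhammer z n) \<le> pochhammer b n"
proof (induction n)
  case (Suc n)
  have "norm (z + of_nat n) \<le> b + real n"
    using norm_triangle_ineq[of z "of_nat n"] assms by simp
  then show ?case
    unfolding pochhammer_Suc norm_mult using Suc order_trans[OF norm_ge_zero] by (intro mult_mono) blast+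
qed simp

text \<open>
  On the right half-plane \<open>norm (a + k) \<le> norm (2a + k)\<close>, so the quotient
  \<open>pochhammer a k / pochhammer (2*a) k\<close> is bounded by 1 and a binomial series is a majorant near each
  point.
\<close>

lemma hyp_sum_holomorphic:
  assumes x: "norm x < 1"
  shows "hyp_sum x holomorphic_on {a :: complex. Re a > 0}"
proof (rule holomorphic_uniform_sequence)
  have nz: "pochhammer (2*a) n \<noteq> 0" if "Re a > 0" for a :: complex and n
  proof (rule pochhammer_double_nz, rule notI)
    assume "2 * a \<in> \<int>\<^sub>\<le>\<^sub>0"
    then obtain m where "2 * a = - of_nat m" by (elim nonpos_Ints_cases')
    then have "Re (2 * a) = - real m" by (simp only: uminus_complex.sel complex_Re_of_nat)
    then show False using that by simp
  qed
  show "open {a :: complex. Re a > 0}" by (rule open_halfspace_Re_gt)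
  show "(\<lambda>a. \<Sum>k<n. hyp_term x a k) holomorphic_on {a. Re a > 0}" for n
    unfolding hyp_term_def using nz
    by (intro holomorphic_intros) (auto simp flip: pochhammer_fact)
  fix z :: complex assume "z \<in> {a. Re a > 0}"
  then have z: "Re z > 0" by simp
  \<comment> \<open>a bound for \<open>norm (1 - a/2)\<close> on the disc of radius \<open>Re z / 2\<close>\<close>
  define b where "b = 1 + (norm z + Re z / 2) / 2"
  have sub: "Re a > 0" "norm a \<le> norm z + Re z / 2" if "a \<in> cball z (Re z / 2)" for a
  proof -
    have d: "norm (z - a) \<le> Re z / 2" using that by (simp add: dist_norm)
    then show "Re a > 0" using z abs_Re_le_cmod[of "z - a"] by simp
    show "norm a \<le> norm z + Re z / 2" using d norm_triangle_ineq4[of z "z - a"] by simp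
  qed
  have "uniform_limit (cball z (Re z / 2)) (\<lambda>n a. \<Sum>k<n. hyp_term x a k) (hyp_sum x) sequentially"
    unfolding hyp_sum_def
  proof (rule Weierstrass_m_test)
    have "(\<lambda>k. (- b gchoose k) * (- norm x) ^ k) sums (1 + - norm x) powr (- b)"
      using x by (intro gen_binomial_real) auto
    moreover have "(- b gchoose k) * (- norm x) ^ k = pochhammer b k / fact k * norm x ^ k" for k
      by (simp add: gbinomial_pochhammer power_minus[of "norm x"])
    ultimately show "summable (\<lambda>k. pochhammer b k / fact k * norm x ^ k)"
      by (simp add: sums_iff)
    fix k and a :: complex assume "a \<in> cball z (Re z / 2)"
    note a = sub[OF this]
    have "norm (pochhammer a k) \<le> norm (pochhammer (2*a) k)"
    proof (induction k)
      case (Suc k)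
      have "norm (a + of_nat k) \<le> norm (2*a + of_nat k)"
        unfolding cmod_def using a(1) by (intro real_sqrt_le_mono add_mono power2_mono) auto
      then show ?case unfolding pochhammer_Suc norm_mult using Suc by (intro mult_mono) auto
    qed simp
    then have 1: "norm (pochhammer a k / pochhammer (2*a) k) \<le> 1"
      using nz[OF a(1), of k] by (simp add: norm_divide)
    have "norm (1 - a/2) \<le> 1 + norm a / 2"
      using norm_triangle_ineq4[of 1 "a/2"] by (simp add: norm_divide)
    also have "1 + norm a / 2 \<le> b" unfolding b_def using a(2) by simp
    finally have "norm (1 - a/2) \<le> b" .
    then have 2: "norm (pochhammer (1 - a/2) k) \<le> pochhammer b k" by (rule norm_pochhammer_le)
    have "norm (hyp_term x a k) = norm (pochhammer a k / pochhammer (2*a) k) * (norm (pochhammer (1 - a/2) k) / fact k * norm x ^ k)"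
      by (simp add: hyp_term_def norm_mult norm_divide norm_power flip: pochhammer_fact)
    also have "\<dots> \<le> 1 * (pochhammer b k / fact k * norm x ^ k)"
      using 1 2 order_trans[OF norm_ge_zero 2] by (intro mult_mono divide_right_mono) auto
    finally show "norm (hyp_term x a k) \<le> pochhammer b k / fact k * norm x ^ k" by simp
  qed
  then show "\<exists>d>0. cball z d \<subseteq> {a. Re a > 0} \<and> uniform_limit (cball z d) (\<lambda>n a. \<Sum>k<n. hyp_term x a k) (hyp_sum x) sequentially"
    using z sub(1) by (intro exI[of _ "Re z / 2"]) auto
qed

lemma hyp_sum_closed_form_right_half_plane:
  fixes x :: real
  assumes x: "x^2 = 1 - x" "0 < x" "x < 1" and a: "Re a > 0"
  shows "hyp_sum (of_real x) a = of_real (gamma_const x) * gamma_side x a"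
proof -
  define S where "S = {a :: complex. Re a > 0}"
  define f where "f = (\<lambda>a. hyp_sum (of_real x) a - of_real (gamma_const x) * gamma_side x a)"
  have "f a = 0"
  proof (rule analytic_continuation[of f S "of_real ` {0<..2}" 1])
    have "hyp_sum (of_real x) holomorphic_on S" unfolding S_def using x by (intro hyp_sum_holomorphic) auto
    moreover have "gamma_side x holomorphic_on S"
      unfolding gamma_side_def
    proof (intro holomorphic_intros)
      show "a + 1/2 \<notin> \<int>\<^sub>\<le>\<^sub>0" if "a \<in> S" for a
        using that by (auto simp: S_def elim!: nonpos_Ints_cases' simp: complex_eq_iff)
    qed auto
    ultimately show "f holomorphic_on S" unfolding f_def by (intro holomorphic_intros)
    show "open S" unfolding S_def by (rule open_halfspace_Re_gt)
    show "connected S" unfolding S_def by (intro convex_connected convex_halfspace_Re_gt)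
    show "of_real ` {0<..2} \<subseteq> S" "1 \<in> S" "a \<in> S" using a by (auto simp: S_def)
    have "(1::real) islimpt {0<..2}"
      by (rule islimpt_subset[of _ "{0<..<2}"]) (auto intro!: interior_limit_point)
    moreover have "dist (of_real u) (1::complex) = dist u 1" for u :: real
      using dist_of_real[of u 1, where 'a = complex] by simp
    ultimately show "(1::complex) islimpt of_real ` {0<..2}"
      unfolding islimpt_approachable by auto
    show "f z = 0" if "z \<in> of_real ` {0<..2}" for z
      using that hyp_sum_real_closed_form[OF x] by (auto simp: f_def)
  qed
  then show ?thesis by (simp add: f_def)
qed

lemma gamma_side_recurrence:
  fixes x :: real
  assumes x: "0 < x" and a: "2 * a \<notin> \<int>\<^sub>\<le>\<^sub>0"
  shows "(3 + of_real x) * (5*a+4) * (5*a+6) * gamma_side x (a+2) = 16 * (2*a+1) * (2*a+3) * gamma_side x a"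
proof -
  define e where "e = exp (a / 2 * of_real (ln (4 * limit_ratio x)))"
  define p where "p = rGamma (a/2 + 2/5 + 1)"
  define q where "q = rGamma (a/2 + 3/5 + 1)"
  define g where "g = Gamma (a + 1/2)"
  have np: "a + 1/2 \<notin> \<int>\<^sub>\<le>\<^sub>0" "a + 1/2 + 1 \<notin> \<int>\<^sub>\<le>\<^sub>0"
  proof -
    have "b \<notin> \<int>\<^sub>\<le>\<^sub>0" if "2 * b = 2 * a + of_nat m" for b m
    proof
      assume "b \<in> \<int>\<^sub>\<le>\<^sub>0"
      then have "of_nat 2 * b - of_nat m \<in> \<int>\<^sub>\<le>\<^sub>0" by (intro nonpos_Ints_diff_Nats Nats_mult_nonpos_Ints) auto
      then show False using that a by simp
    qed
    from this[of _ 1] this[of _ 3] show "a + 1/2 \<notin> \<int>\<^sub>\<le>\<^sub>0" "a + 1/2 + 1 \<notin> \<int>\<^sub>\<le>\<^sub>0" by (auto simp: algebra_simps)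
  qed
  have G: "Gamma (a + 2 + 1/2) = (a + 1/2 + 1) * ((a + 1/2) * g)"
    using Gamma_plus1[OF np(1)] Gamma_plus1[OF np(2)] by (simp add: g_def add_ac)
  have r: "rGamma (a/2 + 2/5) = (a/2 + 2/5) * p" "rGamma (a/2 + 3/5) = (a/2 + 3/5) * q"
    unfolding p_def q_def by (simp_all only: rGamma_plus1)
  have r': "(a + 2)/2 + 2/5 = a/2 + 2/5 + 1" "(a + 2)/2 + 3/5 = a/2 + 3/5 + 1"
    by (simp_all add: field_simps)
  have pos: "4 * limit_ratio x > 0" using x by (simp add: limit_ratio_def)
  define c where "c = 3 + complex_of_real x"
  have E: "exp ((a + 2) / 2 * of_real (ln (4 * limit_ratio x))) = e * (16 / (25 * c))"
  proof -
    define L where "L = complex_of_real (ln (4 * limit_ratio x))"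
    have "exp L = of_real (4 * limit_ratio x)"
      using pos unfolding L_def by (simp only: exp_of_real exp_ln)
    moreover have "(a + 2) / 2 * L = a / 2 * L + L" by (simp add: field_simps)
    ultimately have "exp ((a + 2) / 2 * L) = exp (a / 2 * L) * of_real (4 * limit_ratio x)"
      by (simp only: exp_add)
    then show ?thesis unfolding e_def L_def[symmetric] by (simp add: limit_ratio_def c_def)
  qed
  define P Q R S where "P = a/2 + 2/5" and "Q = a/2 + 3/5" and "R = a + 1/2" and "S = a + 1/2 + 1"
  have lin: "5*a+4 = 10 * P" "5*a+6 = 10 * Q" "2*a+1 = 2 * R" "2*a+3 = 2 * S"
    by (simp_all add: P_def Q_def R_def S_def)
  have c: "c \<noteq> 0"
    using x by (auto simp: c_def complex_eq_iff)
  have "gamma_side x (a + 2) = e * (16 / (25 * c)) * (S * (R * g)) * p * q"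
    unfolding gamma_side_def G E r' p_def[symmetric] q_def[symmetric] R_def S_def ..
  moreover have "gamma_side x a = e * g * (P * p) * (Q * q)"
    unfolding gamma_side_def r e_def[symmetric] g_def[symmetric] P_def Q_def ..
  ultimately show ?thesis using c unfolding lin c_def[symmetric] by simp
qed

text \<open>
  Descending by steps of 2 from the right half-plane, the recurrence can be solved for \<open>f a\<close>:
  \<open>2a + 1\<close> and \<open>2a + 3\<close> are nonzero. It could not always be solved for \<open>f (a + 2)\<close>, because
  \<open>5a + 4\<close> and \<open>5a + 6\<close> may vanish.
\<close>

lemma hyp_sum_closed_form:
  fixes x :: real and a :: complex
  assumes x: "x^2 = 1 - x" "0 < x" "x < 1" and a: "2 * a \<notin> \<int>\<^sub>\<le>\<^sub>0"
  shows "hyp_sum (of_real x) a = of_real (gamma_const x) * gamma_side x a"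
proof -
  have "hyp_sum (of_real x) a = of_real (gamma_const x) * gamma_side x a" if "Re a + 2 * real n > 0" "2 * a \<notin> \<int>\<^sub>\<le>\<^sub>0" for n a
    using that
  proof (induction n arbitrary: a)
    case 0
    then show ?case by (intro hyp_sum_closed_form_right_half_plane[OF x]) auto
  next
    case (Suc n)
    have "2 * (a + 2) \<notin> \<int>\<^sub>\<le>\<^sub>0"
      using Suc.prems nonpos_Ints_diff_Nats[of "2 * (a + 2)" 4] by auto
    then have IH: "hyp_sum (of_real x) (a + 2) = of_real (gamma_const x) * gamma_side x (a + 2)"
      using Suc.prems by (intro Suc.IH) auto
    have x': "complex_of_real x ^ 2 = 1 - of_real x" using x(1) by (metis of_real_1 of_real_diff of_real_power)
    have "16 * (2*a+1) * (2*a+3) * hyp_sum (of_real x) a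
        = of_real (gamma_const x) * ((3 + of_real x) * (5*a+4) * (5*a+6) * gamma_side x (a + 2))"
      using hyp_sum_recurrence[OF x' _ Suc.prems(2)] x(2,3) unfolding IH by (simp add: mult_ac)
    also have "\<dots> = 16 * (2*a+1) * (2*a+3) * (of_real (gamma_const x) * gamma_side x a)"
      unfolding gamma_side_recurrence[OF x(2) Suc.prems(2)] by simp
    finally have "16 * (2*a+1) * (2*a+3) * hyp_sum (of_real x) a = 16 * (2*a+1) * (2*a+3) * (of_real (gamma_const x) * gamma_side x a)" .
    moreover have "2*a+1 \<noteq> 0" "2*a+3 \<noteq> 0"
      using plus_of_nat_eq_0_imp[of "2*a" 1] plus_of_nat_eq_0_imp[of "2*a" 3] Suc.prems(2) by auto
    then have "16 * (2*a+1) * (2*a+3) \<noteq> 0" by (simp only: mult_eq_0_iff) simp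
    ultimately show ?case by (metis mult_left_cancel)
  qed
  moreover obtain n :: nat where "- Re a / 2 < real n" using reals_Archimedean2 by blast
  then have "Re a + 2 * real n > 0" by linarith
  ultimately show ?thesis using a by blast
qed

text \<open>
  The duplication formula at \<open>2/5\<close> trades \<open>Gamma (2/5)\<close> for \<open>Gamma (4/5) / Gamma (9/10)\<close>.
\<close>

lemma gamma_const_golden:
  "gamma_const ((sqrt 5 - 1) / 2) =
     sqrt 5 / (sqrt 5 - 1) * 2 powr (1/5) * Gamma (3/5) * Gamma (4/5) / Gamma (9/10)"
proof -
  define s where "s = sqrt 5"
  have s: "s * s = 5" "s > 1" by (simp_all add: s_def)
  have nz: "Gamma (2/5 :: real) \<noteq> 0" "Gamma (3/5 :: real) \<noteq> 0" "Gamma (9/10 :: real) \<noteq> 0"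
    by (auto simp: Gamma_eq_zero_iff dest!: nonpos_Ints_nonpos)
  have np: "(1/2 :: real) \<notin> \<int>\<^sub>\<le>\<^sub>0" "(2/5 :: real) \<notin> \<int>\<^sub>\<le>\<^sub>0" "(3/5 :: real) \<notin> \<int>\<^sub>\<le>\<^sub>0"
    by (auto dest!: nonpos_Ints_nonpos)
  have G: "Gamma (3/2 :: real) = 1/2 * Gamma (1/2)" "Gamma (7/5 :: real) = 2/5 * Gamma (2/5)" "Gamma (8/5 :: real) = 3/5 * Gamma (3/5)"
    using Gamma_plus1[of "1/2 :: real"] Gamma_plus1[of "2/5 :: real"] Gamma_plus1[of "3/5 :: real"] np
    by simp_all
  have "gamma_quot 1 = Gamma (3/2) / (Gamma (7/5) * Gamma (8/5))" by (simp add: gamma_quot_def)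
  then have q: "gamma_quot 1 = (sqrt pi / 2) / (6/25 * Gamma (2/5) * Gamma (3/5))"
    unfolding G Gamma_one_half_real by simp
  have dup: "Gamma (2/5) = 2 powr (1/5) * sqrt pi * Gamma (4/5) / Gamma (9/10 :: real)"
    using Gamma_duplication_real[of "2/5"] nz by (simp add: field_simps)
  have "(3 + (s - 1) / 2) / 2 = s / (s - 1)" using s by (simp add: field_simps)
  moreover have "2 / (25 * limit_ratio ((s - 1) / 2)) = (3 + (s - 1) / 2) / 2"
    unfolding limit_ratio_def by simp
  ultimately have "2 / (25 * limit_ratio ((s - 1) / 2)) = s / (s - 1)" by (rule trans[rotated])
  moreover have "gamma_const ((s - 1) / 2) = 2 / (25 * limit_ratio ((s - 1) / 2)) * (Gamma (2/5) * Gamma (3/5) / sqrt pi)"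
    unfolding gamma_const_def q using nz by simp
  ultimately have "gamma_const ((s - 1) / 2) = s / (s - 1) * (Gamma (2/5) * Gamma (3/5) / sqrt pi)"
    by simp
  then show ?thesis unfolding s_def[symmetric] dup by simp
qed

lemma ln_limit_ratio_golden:
  "ln (4 * limit_ratio ((sqrt 5 - 1) / 2)) = - 5/2 * ln 5 + ln (sqrt 5 - 1) + 3 * ln 2"
proof -
  define s where "s = sqrt 5"
  have s: "s * s = 5" "s > 1" by (simp_all add: s_def)
  have "ln s = ln 5 / 2" unfolding s_def by (simp add: ln_sqrt)
  have "4 * limit_ratio ((s - 1) / 2) = (s - 1) * 2 ^ 3 / (25 * s)"
    using s by (simp add: limit_ratio_def divide_simps) (simp add: algebra_simps)
  also have "ln \<dots> = (ln (s - 1) + ln (2 ^ 3)) - (ln 25 + ln s)"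
  proof -
    have "ln ((s - 1) * 2 ^ 3 / (25 * s)) = ln ((s - 1) * 2 ^ 3) - ln (25 * s)"
      using s by (subst ln_div) auto
    also have "ln ((s - 1) * 2 ^ 3) = ln (s - 1) + ln (2 ^ 3)" using s by (intro ln_mult_pos) auto
    also have "ln (25 * s) = ln 25 + ln s" using s by (intro ln_mult_pos) auto
    finally show ?thesis .
  qed
  also have "ln 25 = 2 * ln (5 :: real)" using ln_realpow[of 5 2] by simp
  also have "ln (2 ^ 3) = 3 * ln (2 :: real)" using ln_realpow[of 2 3] by simp
  also have "(ln (s - 1) + 3 * ln 2) - (2 * ln 5 + ln s) = - 5/2 * ln 5 + ln (s - 1) + 3 * ln 2"
    unfolding \<open>ln s = ln 5 / 2\<close> by simp
  finally show ?thesis by (simp add: s_def)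
qed

lemma gamma_side_golden:
  "of_real (gamma_const ((sqrt 5 - 1) / 2)) * gamma_side ((sqrt 5 - 1) / 2) a =
     of_real 5 powr (1 / 2 - 5 * a / 4) * of_real (sqrt 5 - 1) powr (a / 2 - 1)
       * Gamma (3 / 5) * Gamma (4 / 5) * Gamma (a + 1 / 2)
       / (of_real 2 powr (- 3 * a / 2 - 1 / 5) * Gamma (9 / 10))
       * rGamma (a / 2 + 2 / 5) * rGamma (a / 2 + 3 / 5)"
proof -
  define A B C where "A = complex_of_real (ln 5)" and "B = complex_of_real (ln (sqrt 5 - 1))"
    and "C = complex_of_real (ln 2)"
  have s: "sqrt 5 > 1" by simp
  have powr: "complex_of_real b powr w = exp (w * of_real (ln b))" if "b > 0" for b w
    using that by (simp add: powr_def Ln_of_real)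
  have pw: "complex_of_real 5 powr w = exp (w * A)" "complex_of_real (sqrt 5 - 1) powr w = exp (w * B)"
    "complex_of_real 2 powr w = exp (w * C)" for w
    unfolding A_def B_def C_def by (rule powr, simp)+
  have "sqrt 5 / (sqrt 5 - 1) * 2 powr (1/5) = exp (ln 5 / 2 - ln (sqrt 5 - 1) + ln 2 / 5)"
    using s by (simp add: exp_add exp_diff powr_def flip: ln_sqrt)
  then have k: "complex_of_real (sqrt 5 / (sqrt 5 - 1) * 2 powr (1/5)) = exp (A / 2 - B + C / 5)"
    by (simp add: A_def B_def C_def flip: exp_of_real)
  have G: "complex_of_real (Gamma (3/5)) = Gamma (3/5)" "complex_of_real (Gamma (4/5)) = Gamma (4/5)"
     "complex_of_real (Gamma (9/10)) = Gamma (9/10)"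
    by (simp_all flip: Gamma_complex_of_real)
  have l: "complex_of_real (ln (4 * limit_ratio ((sqrt 5 - 1) / 2))) = - 5/2 * A + B + 3 * C"
    unfolding ln_limit_ratio_golden by (simp add: A_def B_def C_def)
  have "exp (A / 2 - B + C / 5) * exp (a / 2 * (- 5/2 * A + B + 3 * C))
      = exp ((1/2 - 5 * a / 4) * A) * exp ((a / 2 - 1) * B) / exp ((- 3 * a / 2 - 1/5) * C)"
    unfolding exp_add[symmetric] exp_diff[symmetric] by (simp add: algebra_simps)
  moreover have "of_real (gamma_const ((sqrt 5 - 1) / 2)) * gamma_side ((sqrt 5 - 1) / 2) a
     = (exp (A / 2 - B + C / 5) * exp (a / 2 * (- 5/2 * A + B + 3 * C)))
        * (Gamma (3/5) * Gamma (4/5) / Gamma (9/10) * Gamma (a + 1/2) * rGamma (a/2 + 2/5) * rGamma (a/2 + 3/5))"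
    unfolding gamma_side_def l k[symmetric] G[symmetric] gamma_const_golden by simp
  ultimately show ?thesis unfolding pw by simp
qed

lemma powr_five_half_integer: "5 powr (5 * real n / 2 + 1/2) = sqrt 5 ^ (5 * n + 1)"
proof -
  have "sqrt 5 ^ (5 * n + 1) = (5 powr (1/2)) powr real (5 * n + 1)"
    by (simp add: powr_half_sqrt powr_realpow del: of_nat_Suc of_nat_add power_Suc)
  also have "\<dots> = 5 powr (5 * real n / 2 + 1/2)"
    unfolding powr_powr by (simp add: field_simps)
  finally show ?thesis ..
qed

theorem mainTheorem16:
  shows "(\<forall>a::complex. 2 * a \<notin> \<int>\<^sub>\<le>\<^sub>0 \<longrightarrow>
            gauss_hypergeo a (1 - a / 2) (2 * a) (of_real (- 1 / 2 + sqrt 5 / 2)) =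
              of_real 5 powr (1 / 2 - 5 * a / 4) * of_real (sqrt 5 - 1) powr (a / 2 - 1)
                * Gamma (3 / 5) * Gamma (4 / 5) * Gamma (a + 1 / 2)
              / (of_real 2 powr (- 3 * a / 2 - 1 / 5) * Gamma (9 / 10))
              * rGamma (a / 2 + 2 / 5) * rGamma (a / 2 + 3 / 5))
       \<and> (\<forall>(a::complex) (n::nat). a = - 2 - 2 * of_nat n \<longrightarrow>
            gauss_hypergeo a (1 - a / 2) (2 * a) (of_real (- 1 / 2 + sqrt 5 / 2)) =
              of_real (5 powr (5 * real n / 2 + 1 / 2)) * of_real (sqrt 5 + 1) ^ (n + 1)
                * pochhammer (8 / 5) n * pochhammer (7 / 5) n
              / (2 ^ (7 * n + 2) * pochhammer (7 / 4) n * pochhammer (5 / 4) n))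
       \<and> (\<forall>(a::complex) (n::nat). a = - 1 - 2 * of_nat n \<longrightarrow>
            gauss_hypergeo a (1 - a / 2) (2 * a) (of_real (- 1 / 2 + sqrt 5 / 2)) =
              of_real (5 powr (5 * real n / 2 + 1 / 2)) * of_real (sqrt 5 + 1) ^ (n + 2)
                * pochhammer (11 / 10) n * pochhammer (9 / 10) n
              / (2 ^ (7 * n + 4) * pochhammer (5 / 4) n * pochhammer (3 / 4) n))"
proof -
  define x where "x = (sqrt 5 - 1) / 2"
  have arg: "- 1 / 2 + sqrt 5 / 2 = x" by (simp add: x_def field_simps)
  have "sqrt 5 < 3" by (rule real_less_lsqrt) auto
  then have x: "x^2 = 1 - x" "0 < x" "x < 1"
    by (simp_all add: x_def field_simps power2_eq_square)
  define s where "s = complex_of_real (sqrt 5)"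
  have s: "s^2 = 5" unfolding s_def by (metis of_real_numeral of_real_power real_sqrt_pow2 zero_le_numeral)
  have xs: "complex_of_real x = (s - 1) / 2" by (simp add: x_def s_def)
  have sq: "complex_of_real (5 powr (5 * real n / 2 + 1 / 2)) = s ^ (5 * n + 1)"
     "complex_of_real (sqrt 5 + 1) = s + 1" for n
    unfolding powr_five_half_integer by (simp_all add: s_def)
  have "gauss_hypergeo a (1 - a / 2) (2 * a) (of_real x) = of_real (gamma_const x) * gamma_side x a"
    if "2 * a \<notin> \<int>\<^sub>\<le>\<^sub>0" for a
    unfolding gauss_hypergeo_eq_hyp_sum[OF that] by (rule hyp_sum_closed_form[OF x that])
  moreover have "gauss_hypergeo a (1 - a / 2) (2 * a) (of_real x) = hyp_sum ((s - 1) / 2) a"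
    if "a = - 2 - 2 * of_nat n" for a n
    unfolding xs[symmetric] using that by (intro gauss_hypergeo_neg_eq_hyp_sum[of _ "2 * n + 2"]) auto
  moreover have "gauss_hypergeo a (1 - a / 2) (2 * a) (of_real x) = hyp_sum ((s - 1) / 2) a"
    if "a = - 1 - 2 * of_nat n" for a n
    unfolding xs[symmetric] using that by (intro gauss_hypergeo_neg_eq_hyp_sum[of _ "2 * n + 1"]) auto
  ultimately show ?thesis
    unfolding arg sq gamma_side_golden[symmetric] x_def[symmetric]
    using hyp_sum_minus_even[OF s] hyp_sum_minus_odd[OF s] by simp
qed

end
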